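(* Let $n\ge1$, $1<p<\infty$, $1<q<\infty$, $0<\gamma<1$, and let $w\in RH^+_q$ be a weight on $\mathbb{R}^{n+1}$ that is forward in time parabolic doubling, i.e. there is a constant $c_d>0$ such that $$w(R^-(\gamma))\le c_d\,w\Bigl(\frac12R^+(\gamma)\Bigr)$$ for every parabolic rectangle $R\subset\mathbb{R}^{n+1}$. Then $w\in A^+_r(\gamma)$ for some $r>1$.
   Context: Points of $\mathbb{R}^{n+1}$ are written $(x,t)$ with $x\in\mathbb{R}^n$, $t\in\mathbb{R}$. For $x\in\mathbb{R}^n$, $t\in\mathbb{R}$, $L>0$ let $Q(x,L)=\{y\in\mathbb{R}^n:|y_i-x_i|\le L/2,\ i=1,\dots,n\}$. A parabolic rectangle is a set $R=R(x,t,L)=Q(x,L)\times(t-L^p,t+L^p)$. For $0\le\gamma<1$ put $$R^+(\gamma)=Q(x,L)\times(t+\gamma L^p,t+L^p),\qquad R^-(\gamma)=Q(x,L)\times(t-L^p,t-\gamma L^p),$$ and $R^\pm=R^\pm(0)$. Moreover $$\frac12R^+(\gamma)=Q\Bigl(x,\frac L2\Bigr)\times\Bigl(t+\frac{1+\gamma}2L^p-\frac{1-\gamma}2\frac{L^p}{2^p},\ t+\frac{1+\gamma}2L^p+\frac{1-\gamma}2\frac{L^p}{2^p}\Bigr).$$ A weight is a locally integrable nonnegative function on $\mathbb{R}^{n+1}$; $|A|$ is Lebesgue measure and $w(A)=\int_Aw\,dx\,dt$. $w\in RH^+_q$ means there is a constant $C$ with $\bigl(\frac1{|R^-|}\int_{R^-}w^q\bigr)^{1/q}\le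 C\frac1{|R^+|}\int_{R^+}w$ for every parabolic rectangle $R$. For $1<r<\infty$ and $0<\gamma<1$, $w\in A^+_r(\gamma)$ means $$\sup_{R}\Bigl(\frac1{|R^-(\gamma)|}\int_{R^-(\gamma)}w\Bigr)\Bigl(\frac1{|R^+(\gamma)|}\int_{R^+(\gamma)}w^{\frac1{1-r}}\Bigr)^{r-1}<\infty,$$ the supremum being over all parabolic rectangles $R\subset\mathbb{R}^{n+1}$. Negative powers of $w$ are $+\infty$ where $w=0$, and $0\cdot\infty=0$. *)

theory Defs
  imports "HOL-Analysis.Analysis"
begin

definition cube :: "real ^ 'n \<Rightarrow> real \<Rightarrow> (real ^ 'n) set" where
  "cube x L = {y. \<forall>i. \<bar>y $ i - x $ i\<bar> \<le> L / 2}"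

definition para_upper :: "real \<Rightarrow> real \<Rightarrow> real ^ 'n \<Rightarrow> real \<Rightarrow> real \<Rightarrow> ((real ^ 'n) \<times> real) set" where
  "para_upper p \<gamma> x t L = cube x L \<times> {t + \<gamma> * L powr p <..< t + L powr p}"

definition para_lower :: "real \<Rightarrow> real \<Rightarrow> real ^ 'n \<Rightarrow> real \<Rightarrow> real \<Rightarrow> ((real ^ 'n) \<times> real) set" where
  "para_lower p \<gamma> x t L = cube x L \<times> {t - L powr p <..< t - \<gamma> * L powr p}"

definition half_para_upper :: "real \<Rightarrow> real \<Rightarrow> real ^ 'n \<Rightarrow> real \<Rightarrow> real \<Rightarrow> ((real ^ 'n) \<times> real) set" where
  "half_para_upper p \<gamma> x t L = cube x (L / 2) \<times>
     {t + (1 + \<gamma>) / 2 * L powr p - (1 - \<gamma>) / 2 * (L powr p / 2 powr p) <..<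
      t + (1 + \<gamma>) / 2 * L powr p + (1 - \<gamma>) / 2 * (L powr p / 2 powr p)}"

text \<open>Real powers of extended nonnegative reals. In contrast to \<^const>\<open>powr\<close>, a negative
  power of zero is infinite. The product \<open>0 * \<infinity>\<close> is already zero in \<^typ>\<open>ennreal\<close>.\<close>

definition ennpowr :: "ennreal \<Rightarrow> real \<Rightarrow> ennreal" where
  "ennpowr u a =
    (if a > 0 \<and> u = \<infinity> \<or> a < 0 \<and> u = 0 then \<infinity>
     else if a = 0 then 1
     else ennreal (enn2real u powr a))"

definition avg :: "'a::euclidean_space set \<Rightarrow> ('a \<Rightarrow> ennreal) \<Rightarrow> ennreal" where
  "avg A f = (\<integral>\<^sup>+ z\<in>A. f z \<partial>lebesgue) / emeasure lebesgue A"

definition weight :: "('a::euclidean_space \<Rightarrow> real) \<Rightarrow> bool" where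
  "weight w \<longleftrightarrow> (\<forall>z. 0 \<le> w z) \<and> (\<forall>K. compact K \<longrightarrow> set_integrable lebesgue K w)"

definition wmeasure :: "('a::euclidean_space \<Rightarrow> real) \<Rightarrow> 'a set \<Rightarrow> ennreal" where
  "wmeasure w A = (\<integral>\<^sup>+ z\<in>A. ennreal (w z) \<partial>lebesgue)"

text \<open>A parabolic rectangle is given by its centre \<open>(x, t)\<close> and its side length \<open>L > 0\<close>, so
  quantifying over parabolic rectangles means quantifying over these parameters. All averages are
  taken in \<^typ>\<open>ennreal\<close>: no integrability of \<open>w\<^sup>q\<close> or of the negative power of \<open>w\<close> is presupposed.\<close>

definition RH_plus :: "real \<Rightarrow> real \<Rightarrow> ((real ^ 'n) \<times> real \<Rightarrow> real) set" where
  "RH_plus p q = {w. weight w \<and>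
     (\<exists>C::real. \<forall>x t L. L > 0 \<longrightarrow>
        ennpowr (avg (para_lower p 0 x t L) (\<lambda>z. ennpowr (ennreal (w z)) q)) (1 / q)
          \<le> ennreal C * avg (para_upper p 0 x t L) (\<lambda>z. ennreal (w z)))}"

definition A_plus :: "real \<Rightarrow> real \<Rightarrow> real \<Rightarrow> ((real ^ 'n) \<times> real \<Rightarrow> real) set" where
  "A_plus p r \<gamma> = {w. weight w \<and>
     (SUP (x, t, L) \<in> {(x, t, L). L > 0}.
        avg (para_lower p \<gamma> x t L) (\<lambda>z. ennreal (w z)) *
        ennpowr (avg (para_upper p \<gamma> x t L) (\<lambda>z. ennpowr (ennreal (w z)) (1 / (1 - r)))) (r - 1))
     < \<infinity>}"

definition forward_doubling :: "real \<Rightarrow> real \<Rightarrow> ((real ^ 'n) \<times> real \<Rightarrow> real) \<Rightarrow> bool" where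
  "forward_doubling p \<gamma> w \<longleftrightarrow>
     (\<exists>c::real. c > 0 \<and> (\<forall>x t L. L > 0 \<longrightarrow>
        wmeasure w (para_lower p \<gamma> x t L) \<le> ennreal c * wmeasure w (half_para_upper p \<gamma> x t L)))"

end

theory Submission
  imports Defs
begin

text \<open>Forward doubling, used with rectangles much smaller than the time lag and iterated, compares
  the \<open>w\<close>-mass of a small box with that of any box in its future that is within reach of a
  chain; since \<open>p > 1\<close>, chains of small rectangles cover any spatial distance in an arbitrarily
  short time. Hence \<open>w(R\<^sup>-(\<gamma>))\<close> bounds from below the mass of every box of side \<open>\<sigma>L\<close> in the
  recent past of a point of \<open>R\<^sup>+(\<gamma>)\<close>.

  Fix a level \<open>\<tau>\<close> and a point \<open>z\<close> with \<open>w(z) < \<tau> / 2\<close>, and shrink boxes lying in the past of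
  \<open>z\<close> until their mean drops below \<open>\<tau>\<close>. Between the last two of these boxes there is one whose
  mean is at least \<open>\<tau> / C\<close> by doubling, and whose \<open>L\<^sup>q\<close> mean is at most \<open>C\<tau>\<close> by the reverse
  Hoelder inequality, so \<open>w\<close> is comparable to \<open>\<tau>\<close> on a fixed proportion of it. A covering argument
  bounds \<open>|{w < \<tau> / C}|\<close> by a multiple of \<open>|{w < C\<tau>}| - |{w < \<tau> / C}|\<close> on a slightly larger set.
  The enlargement decays geometrically with the level, as the sides of the stopped boxes do.
  Therefore the sublevel sets decay geometrically, which makes a small negative power of \<open>w\<close>
  integrable with the right bound.\<close>

subsection \<open>Boxes, covers and weighted measures\<close>

definition pbox :: "real ^ 'n \<Rightarrow> real \<Rightarrow> real \<Rightarrow> real \<Rightarrow> ((real ^ 'n) \<times> real) set" where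
  "pbox x L a b = cube x L \<times> {a<..<b}"

lemma cube_eq_cbox: "cube x L = cbox (\<chi> i. x $ i - L / 2) (\<chi> i. x $ i + L / 2)"
  unfolding cube_def set_eq_iff mem_Collect_eq mem_box_cart vec_lambda_beta
  by (intro allI iff_allI) (simp only: abs_le_iff, linarith)

lemma emeasure_cube:
  fixes x :: "real ^ 'n::finite"
  assumes "L \<ge> 0"
  shows "emeasure lborel (cube x L) = ennreal (L ^ CARD('n))"
proof -
  have "measure lborel (cube x L) = L ^ CARD('n)"
    using assms unfolding cube_eq_cbox
    by (subst content_cbox_cart) (auto simp: interval_ne_empty_cart)
  moreover have "emeasure lborel (cube x L) < \<infinity>"
    unfolding cube_eq_cbox by (rule emeasure_lborel_cbox_finite)
  ultimately show ?thesis
    by (metis emeasure_eq_ennreal_measure infinity_ennreal_def less_irrefl)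
qed

lemma pbox_borel [measurable]: "pbox x L a b \<in> sets borel"
proof -
  have "cube x L \<in> sets borel" unfolding cube_eq_cbox by simp
  then have "pbox x L a b \<in> sets (borel \<Otimes>\<^sub>M borel)"
    unfolding pbox_def by (intro pair_measureI) auto
  then show ?thesis unfolding borel_prod .
qed

lemma pbox_sets_lebesgue [measurable]: "pbox x L a b \<in> sets lebesgue"
  using pbox_borel by (metis sets_completionI_sets sets_lborel)

lemma emeasure_pbox:
  fixes x :: "real ^ 'n::finite"
  assumes "L \<ge> 0" "a \<le> b"
  shows "emeasure lebesgue (pbox x L a b) = ennreal (L ^ CARD('n) * (b - a))"
proof -
  have c: "cube x L \<in> sets lborel" unfolding cube_eq_cbox by simp
  have "emeasure lebesgue (pbox x L a b) = emeasure lborel (pbox x L a b)"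
    by (simp add: emeasure_completion)
  also have "\<dots> = emeasure (lborel \<Otimes>\<^sub>M lborel) (cube x L \<times> {a<..<b})"
    by (simp add: lborel_prod pbox_def)
  also have "\<dots> = ennreal (L ^ CARD('n)) * ennreal (b - a)"
    using c assms by (simp add: lborel.emeasure_pair_measure_Times emeasure_cube)
  finally show ?thesis using assms by (simp add: ennreal_mult)
qed

lemma measure_pbox:
  fixes x :: "real ^ 'n::finite"
  assumes "L \<ge> 0" "a \<le> b"
  shows "measure lebesgue (pbox x L a b) = L ^ CARD('n) * (b - a)"
  using emeasure_pbox[OF assms, of x] assms by (simp add: measure_def)

lemma bounded_pbox: "bounded (pbox x L a b)"
  unfolding pbox_def cube_eq_cbox 
  by (intro bounded_Times bounded_cbox bounded_subset[OF bounded_closed_interval[of a b]]) auto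

lemma lmeasurable_pbox: "pbox x L a b \<in> lmeasurable"
  by (intro bounded_set_imp_lmeasurable bounded_pbox pbox_sets_lebesgue)

lemma pbox_mono:
  assumes "\<And>i. \<bar>x' $ i - x $ i\<bar> \<le> (L' - L) / 2" "a' \<le> a" "b \<le> b'"
  shows "pbox x L a b \<subseteq> pbox x' L' a' b'"
proof -
  have "\<bar>y $ i - x' $ i\<bar> \<le> L' / 2" if "\<forall>i. \<bar>y $ i - x $ i\<bar> \<le> L / 2" for y i
  proof -
    have "\<bar>y $ i - x' $ i\<bar> \<le> \<bar>y $ i - x $ i\<bar> + \<bar>x' $ i - x $ i\<bar>" by linarith
    also have "\<dots> \<le> L / 2 + (L' - L) / 2" using assms(1)[of i] that by (intro add_mono) auto
    also have "\<dots> = L' / 2" by (simp add: diff_divide_distrib)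
    finally show ?thesis .
  qed
  then show ?thesis using assms(2,3) by (auto simp: pbox_def cube_def)
qed

text \<open>Vitali selection: keep a member of largest \<open>r\<close>, discard every member that
  meets it, and recurse. The alternative \<open>i = j\<close> lets a selected member with empty
  \<open>V i\<close> represent itself.\<close>

lemma greedy_disjoint_subfamily:
  fixes V :: "'i \<Rightarrow> 'a set" and r :: "'i \<Rightarrow> real"
  assumes "finite F"
  shows "\<exists>C\<subseteq>F. (\<forall>i\<in>C. \<forall>j\<in>C. i \<noteq> j \<longrightarrow> V i \<inter> V j = {}) \<and>
    (\<forall>i\<in>F. \<exists>j\<in>C. r i \<le> r j \<and> (V i \<inter> V j \<noteq> {} \<or> i = j))"
  using assms
proof (induction "card F" arbitrary: F rule: less_induct)
  case less
  show ?case
  proof (cases "F = {}")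
    case False
    obtain m where m: "m \<in> F" "\<And>i. i \<in> F \<Longrightarrow> r i \<le> r m"
      using obtains_MAX[of F r] less.prems False by (metis Max_ge finite_imageI imageI)
    define F' where "F' = {i\<in>F. i \<noteq> m \<and> V i \<inter> V m = {}}"
    have "F' \<subset> F" using m by (auto simp: F'_def)
    then obtain C where C: "C \<subseteq> F'" "\<forall>i\<in>C. \<forall>j\<in>C. i \<noteq> j \<longrightarrow> V i \<inter> V j = {}"
      "\<forall>i\<in>F'. \<exists>j\<in>C. r i \<le> r j \<and> (V i \<inter> V j \<noteq> {} \<or> i = j)"
      using less.hyps[of F'] less.prems by (meson psubset_card_mono finite_subset psubset_imp_subset)
    show ?thesis
    proof (intro exI[of _ "insert m C"] conjI ballI impI)
      show "insert m C \<subseteq> F" using C(1) m(1) by (auto simp: F'_def)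
      show "V i \<inter> V j = {}" if "i \<in> insert m C" "j \<in> insert m C" "i \<noteq> j" for i j
        using that C(1,2) by (auto simp: F'_def)
      show "\<exists>j\<in>insert m C. r i \<le> r j \<and> (V i \<inter> V j \<noteq> {} \<or> i = j)" if "i \<in> F" for i
        using that m(2) C(3) by (cases "i \<in> F'") (auto simp: F'_def)
    qed
  qed auto
qed

text \<open>Integrability on balls makes each truncation of \<open>w\<close> measurable, and the
  truncations converge pointwise to \<open>w\<close>.\<close>

lemma weight_measurable:
  fixes w :: "'a::euclidean_space \<Rightarrow> real"
  assumes "weight w"
  shows "w \<in> borel_measurable lebesgue"
proof -
  have *: "(\<lambda>z. indicator (cball 0 (real k)) z *\<^sub>R w z) \<in> borel_measurable lebesgue" for k
    
  proof -
    have "set_integrable lebesgue (cball 0 (real k)) w"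
      using assms compact_cball unfolding weight_def by metis
    then show ?thesis unfolding set_integrable_def by (rule borel_measurable_integrable)
  qed
  have "(\<lambda>k. indicator (cball 0 (real k)) z *\<^sub>R w z) \<longlonglongrightarrow> w z" for z
  proof (rule tendsto_eventually)
    show "\<forall>\<^sub>F k in sequentially. indicator (cball 0 (real k)) z *\<^sub>R w z = w z"
      using eventually_ge_at_top[of "nat \<lceil>norm z\<rceil>"]
      by eventually_elim (auto simp: indicator_def)
  qed
  then show ?thesis by (intro borel_measurable_LIMSEQ_metric[OF *])
qed

section \<open>The measure with density \<open>w\<close>\<close>

definition wmeas :: "('a::euclidean_space \<Rightarrow> real) \<Rightarrow> 'a measure" where
  "wmeas w = density lebesgue (\<lambda>z. ennreal (w z))"

lemma sets_wmeas [simp, measurable_cong]: "sets (wmeas w) = sets lebesgue"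
  by (simp add: wmeas_def)

lemma emeasure_wmeas:
  assumes "weight w" "A \<in> sets lebesgue"
  shows "emeasure (wmeas w) A = wmeasure w A"
  using weight_measurable[OF assms(1)] assms(2)
  by (simp add: wmeas_def wmeasure_def emeasure_density)

lemma wmeas_fmeasurable:
  assumes "weight w" "A \<in> sets lebesgue" "bounded A"
  shows "A \<in> fmeasurable (wmeas w)"
proof -
  obtain r where r: "A \<subseteq> cball 0 r" using assms(3) by (auto simp: bounded_iff subset_iff)
  have int: "integrable lebesgue (\<lambda>z. indicator (cball 0 r) z *\<^sub>R w z)"
    using assms(1) by (auto simp: weight_def set_integrable_def)
  have "wmeasure w A \<le> wmeasure w (cball 0 r)"
    unfolding wmeasure_def using r by (intro nn_integral_mono) (auto simp: indicator_def)
  also have "\<dots> = (\<integral>\<^sup>+z. ennreal (indicator (cball 0 r) z *\<^sub>R w z) \<partial>lebesgue)"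
    unfolding wmeasure_def by (intro nn_integral_cong) (auto simp: indicator_def)
  also have "\<dots> < \<infinity>"
    using assms(1) by (subst nn_integral_eq_integral[OF int]) (auto simp: weight_def)
  finally show ?thesis
    using assms by (intro fmeasurableI) (auto simp: emeasure_wmeas)
qed

lemma wmeasure_eq_measure:
  assumes "weight w" "A \<in> sets lebesgue" "bounded A"
  shows "wmeasure w A = ennreal (measure (wmeas w) A)"
  using wmeas_fmeasurable[OF assms] emeasure_wmeas[OF assms(1,2)]
  by (simp add: fmeasurableD2 emeasure_eq_ennreal_measure)

lemma wmeas_mono:
  assumes "weight w" "A \<subseteq> B" "A \<in> sets lebesgue" "B \<in> sets lebesgue" "bounded B"
  shows "measure (wmeas w) A \<le> measure (wmeas w) B"
  using assms by (intro measure_mono_fmeasurable wmeas_fmeasurable) auto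

text \<open>Continuity from above along the neighbourhoods \<open>U m\<close>, which shrink to
  \<open>K\<close>. It later controls the part of very small boxes near a compact set that sticks
  out of it.\<close>

lemma wmeas_outer:
  fixes K :: "'a::euclidean_space set"
  assumes "weight w" "compact K" "e > 0"
  shows "\<exists>d>0. \<forall>B\<in>sets lebesgue. bounded B \<longrightarrow> (\<forall>z\<in>B. \<exists>k\<in>K. dist k z < d) \<longrightarrow>
    measure (wmeas w) (B - K) < e"
proof (cases "K = {}")
  case True
  then show ?thesis using assms(3) by (intro exI[of _ 1]) auto
next
  case False
  define U where "U m = {z. infdist z K < 1 / real (Suc m)}" for m
  have op: "open (U m)" for m
    unfolding U_def by (intro open_Collect_less continuous_intros)
  have U_le: "\<exists>k\<in>K. dist z k < 1 / real (Suc m)" if z: "z \<in> U m" for z m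
  proof -
    obtain k where "k \<in> K" "infdist z K = dist z k"
      using infdist_attains_inf[of K z] False assms(2) compact_imp_closed by metis
    then show ?thesis using z by (auto simp: U_def)
  qed
  have bd: "bounded (U m)" for m
  proof -
    obtain r where r: "\<And>k. k \<in> K \<Longrightarrow> norm k \<le> r"
      using compact_imp_bounded[OF assms(2)] by (auto simp: bounded_iff)
    have "norm z \<le> r + 1 / real (Suc m)" if z: "z \<in> U m" for z
    proof -
      obtain k where "k \<in> K" "dist z k < 1 / real (Suc m)" using U_le[OF z] by blast
      then show ?thesis using r[of k] norm_triangle_sub[of z k] by (simp add: dist_norm)
    qed
    then show ?thesis by (auto simp: bounded_iff)
  qed
  have Ks: "K \<in> sets lebesgue" using assms(2) by (simp add: lmeasurable_compact fmeasurableD)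
  have Us: "U m \<in> sets lebesgue" for m using op by (simp add: borel_open sets_completionI_sets)
  have INT: "(\<Inter>m. U m - K) = {}"
  proof -
    have "z \<in> K" if "\<And>m. z \<in> U m" for z
    proof -
      have "infdist z K \<le> 0"
      proof (rule ccontr)
        assume "\<not> infdist z K \<le> 0"
        then obtain m where "1 / real (Suc m) < infdist z K"
          by (metis not_le nat_approx_posE)
        then show False using that[of m] by (simp add: U_def)
      qed
      then show ?thesis
        using in_closed_iff_infdist_zero[of K z] compact_imp_closed[OF assms(2)] False
          infdist_nonneg[of z K] by auto
    qed
    then show ?thesis by auto
  qed
  have dec: "decseq (\<lambda>m. U m - K)"
  proof (rule antimonoI)
    fix m k :: nat assume "m \<le> k"
    then have "1 / real (Suc k) \<le> 1 / real (Suc m)" by (simp add: frac_le)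
    then show "U k - K \<subseteq> U m - K" by (auto simp: U_def)
  qed
  have fm: "U m - K \<in> fmeasurable (wmeas w)" for m
    using bd Us Ks assms(1) by (intro wmeas_fmeasurable) (auto intro: bounded_diff)
  have "(\<lambda>m. measure (wmeas w) (U m - K)) \<longlonglongrightarrow> measure (wmeas w) (\<Inter>m. U m - K)"
    using fm dec by (intro Lim_measure_decseq) (simp_all add: fmeasurableD2 image_subset_iff Us Ks sets.Diff)
  then have "(\<lambda>m. measure (wmeas w) (U m - K)) \<longlonglongrightarrow> 0" unfolding INT by simp
  then obtain m where m: "measure (wmeas w) (U m - K) < e"
    using order_tendstoD(2)[OF _ assms(3)] by (metis (no_types, lifting) eventually_sequentially order_refl)
  show ?thesis
  proof (intro exI[of _ "1 / real (Suc m)"] conjI ballI impI)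
    fix B assume B: "B \<in> sets lebesgue" "bounded B" "\<forall>z\<in>B. \<exists>k\<in>K. dist k z < 1 / real (Suc m)"
    have "B \<subseteq> U m"
    proof
      fix z assume "z \<in> B"
      then obtain k where "k \<in> K" "dist k z < 1 / real (Suc m)" using B(3) by blast
      then show "z \<in> U m" using infdist_le[of k K z] by (simp add: U_def dist_commute)
    qed
    then have "measure (wmeas w) (B - K) \<le> measure (wmeas w) (U m - K)"
      using B Ks Us bd assms(1) by (intro wmeas_mono) (auto intro: bounded_diff)
    then show "measure (wmeas w) (B - K) < e" using m by simp
  qed auto
qed

subsection \<open>Chains of boxes\<close>

text \<open>Compactness at unit scale; parabolic scaling then covers every rectangle with the same
  number of boxes.\<close>

lemma unit_box_finite_cover:
  fixes \<sigma> \<tau> :: real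
  assumes "\<sigma> > 0" "\<tau> > 0"
  shows "\<exists>F\<subseteq>cube (0::real^'n::finite) 1 \<times> {0..1::real}. finite F \<and>
    cube 0 1 \<times> {0..1} \<subseteq> (\<Union>z\<in>F. pbox (fst z) \<sigma> (snd z - \<tau>) (snd z + \<tau>))"
proof -
  define S where "S = cube (0::real^'n) 1 \<times> {0..1::real}"
  have "compact S" unfolding S_def cube_eq_cbox by (intro compact_Times compact_cbox compact_Icc)
  define U where "U z = box (\<chi> i. fst z $ i - \<sigma>/2) (\<chi> i. fst z $ i + \<sigma>/2) \<times> {snd z - \<tau><..<snd z + \<tau>}"
    for z :: "(real^'n) \<times> real"
  have U_sub: "U z \<subseteq> pbox (fst z) \<sigma> (snd z - \<tau>) (snd z + \<tau>)" for z
    unfolding U_def pbox_def cube_eq_cbox using box_subset_cbox by blast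
  have "open (U z)" for z unfolding U_def by (intro open_Times open_box open_greaterThanLessThan)
  moreover have "S \<subseteq> (\<Union>z\<in>S. U z)"
    using assms by (auto simp: U_def mem_box_cart)
  ultimately obtain F where "F \<subseteq> S" "finite F" "S \<subseteq> (\<Union>z\<in>F. U z)"
    using compactE_image[OF \<open>compact S\<close>, of S U] by metis
  then show ?thesis using U_sub unfolding S_def by (intro exI[of _ F]) blast
qed

locale forward_doubling_weight =
  fixes w :: "(real^'n::finite) \<times> real \<Rightarrow> real" and p \<gamma> c :: real
  assumes p_gt_1: "1 < p" and \<gamma>_pos: "0 < \<gamma>" and \<gamma>_less_1: "\<gamma> < 1" and weight: "weight w"
    and c_ge_1: "1 \<le> c"
    and doubling: "L > 0 \<Longrightarrow> wmeasure w (para_lower p \<gamma> x t L) \<le> ennreal c * wmeasure w (half_para_upper p \<gamma> x t L)"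
begin

abbreviation "\<mu> A \<equiv> measure (wmeas w) A"

text \<open>\<open>B\<close> has the shape of \<open>para_lower p \<gamma>\<close>, in which
  doubling is stated, and is indexed by its centre in time. \<open>D\<close> has the shape of
  \<open>para_lower p 0\<close>, in which the reverse Hoelder inequality is stated, and is indexed
  by its initial time.\<close>

definition B :: "real^'n \<Rightarrow> real \<Rightarrow> real \<Rightarrow> ((real^'n) \<times> real) set" where
  "B x t l = pbox x l (t - (1 - \<gamma>) / 2 * l powr p) (t + (1 - \<gamma>) / 2 * l powr p)"

definition D :: "real^'n \<Rightarrow> real \<Rightarrow> real \<Rightarrow> ((real^'n) \<times> real) set" where
  "D x u l = pbox x l u (u + l powr p)"

lemma \<mu>_pbox_mono: "A \<subseteq> pbox x L a b \<Longrightarrow> A \<in> sets lebesgue \<Longrightarrow> \<mu> A \<le> \<mu> (pbox x L a b)"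
  by (intro wmeas_mono weight pbox_sets_lebesgue bounded_pbox)

lemma wmeasure_pbox: "wmeasure w (pbox x L a b) = ennreal (\<mu> (pbox x L a b))"
  by (intro wmeasure_eq_measure weight pbox_sets_lebesgue bounded_pbox)

lemma doubling_B:
  assumes "l > 0"
  shows "\<mu> (B x t l) \<le> c * \<mu> (B x (t + (1 + \<gamma>) * l powr p) (l / 2))"
proof -
  \<comment> \<open>The central time of the rectangle whose lower part is centred at
    \<open>t\<close>; the upper half box is then centred \<open>(1 + \<gamma>) * l powr p\<close>
    after \<open>t\<close>.\<close>
  let ?s = "t + (1 + \<gamma>) / 2 * l powr p"
  have 1: "para_lower p \<gamma> x ?s l = B x t l"
    by (simp add: para_lower_def B_def pbox_def field_simps)
  have 2: "half_para_upper p \<gamma> x ?s l = B x (t + (1 + \<gamma>) * l powr p) (l / 2)"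
  proof -
    have "?s + (1 + \<gamma>) / 2 * l powr p = t + (1 + \<gamma>) * l powr p" by (simp add: field_simps)
    then show ?thesis using assms
      by (simp only: half_para_upper_def B_def pbox_def powr_divide[of l 2 p])
  qed
  have "ennreal (\<mu> (B x t l)) \<le> ennreal c * ennreal (\<mu> (B x (t + (1 + \<gamma>) * l powr p) (l / 2)))"
    using doubling[OF assms, of x ?s] unfolding 1 2 by (simp add: B_def wmeasure_pbox)
  then show ?thesis using c_ge_1 by (simp flip: ennreal_mult)
qed

lemma powr_p_le_cancel: "0 \<le> r \<Longrightarrow> 0 \<le> s \<Longrightarrow> r powr p \<le> s powr p \<Longrightarrow> r \<le> s"
  using p_gt_1 by (metis less_le_trans not_less powr_less_mono2 zero_less_one order.strict_trans)

lemma le_powr_p: "1 \<le> r \<Longrightarrow> r \<le> r powr p"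
  using p_gt_1 powr_mono[of 1 p r] by simp

lemma powr_p_le: "0 \<le> r \<Longrightarrow> r \<le> 1 \<Longrightarrow> r powr p \<le> r"
  using p_gt_1 powr_mono'[of 1 p r] by simp

text \<open>The factor 3/2 leaves room for tuning the time lag by the size of the parabolic rectangle,
  and still allows the centre to move in space since the upper half box shrinks by 2.\<close>

lemma B_step:
  assumes l: "l > 0" and T: "(1 + \<gamma>) * l powr p \<le> T" "T \<le> 3 / 2 * (1 + \<gamma>) * l powr p"
    and x: "\<And>i. \<bar>x' $ i - x $ i\<bar> \<le> l / 8"
  shows "\<mu> (B x t l) \<le> c * \<mu> (B x' (t + T) l)"
proof -
  \<comment> \<open>The side for which the lag \<open>(1 + \<gamma>) * s powr p\<close> of doubling
    is exactly \<open>T\<close>. The bounds on \<open>T\<close> put \<open>s\<close> between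
    \<open>l\<close> and \<open>3 / 2 * l\<close>.\<close>
  define s where "s = (T / (1 + \<gamma>)) powr (1 / p)"
  have T0: "T > 0" using T(1) l \<gamma>_pos by (smt (verit) mult_pos_pos powr_gt_zero)
  have sp: "s powr p = T / (1 + \<gamma>)"
    using T0 \<gamma>_pos p_gt_1 by (simp add: s_def powr_powr)
  have s0: "s > 0" using T0 \<gamma>_pos by (simp add: s_def)
  have "l powr p \<le> s powr p" using T(1) \<gamma>_pos by (simp add: sp field_simps)
  then have ls: "l \<le> s" using l s0 by (simp add: powr_p_le_cancel)
  have "s powr p \<le> 3 / 2 * l powr p" using T(2) \<gamma>_pos by (simp add: sp field_simps)
  also have "\<dots> \<le> (3 / 2) powr p * l powr p"
    using le_powr_p[of "3/2"] by (intro mult_right_mono) auto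
  also have "\<dots> = (3 / 2 * l) powr p" using l by (intro powr_mult[symmetric])
  finally have sl: "s \<le> 3 / 2 * l" using l s0 by (intro powr_p_le_cancel[of s "3 / 2 * l"]) simp_all
  have "\<mu> (B x t l) \<le> \<mu> (B x t s)"
    unfolding B_def using ls \<open>l powr p \<le> s powr p\<close> \<gamma>_less_1
    by (intro \<mu>_pbox_mono pbox_mono) (auto intro!: mult_left_mono)
  also have "\<dots> \<le> c * \<mu> (B x (t + T) (s / 2))"
    using doubling_B[OF s0, of x t] \<gamma>_pos by (simp add: sp)
  also have "\<dots> \<le> c * \<mu> (B x' (t + T) l)"
  proof -
    have "(s / 2) powr p \<le> l powr p" using s0 sl p_gt_1 by (intro powr_mono2) auto
    then have *: "(1 - \<gamma>) / 2 * (s / 2) powr p \<le> (1 - \<gamma>) / 2 * l powr p"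
      using \<gamma>_less_1 by (intro mult_left_mono) auto
    \<comment> \<open>Since \<open>s / 2\<close> is at most \<open>3 / 4 * l\<close>, the half box
      fits into a box of side \<open>l\<close> with centre shifted by up to
      \<open>l / 8\<close>.\<close>
    have "\<bar>x' $ i - x $ i\<bar> \<le> (l - s / 2) / 2" for i
    proof -
      have "l / 8 \<le> (l - s / 2) / 2" using sl by (simp add: field_simps)
      then show ?thesis using x[of i] by linarith
    qed
    then have "\<mu> (B x (t + T) (s / 2)) \<le> \<mu> (B x' (t + T) l)"
      unfolding B_def using * by (intro \<mu>_pbox_mono pbox_mono) auto
    then show ?thesis using c_ge_1 by simp
  qed
  finally show ?thesis .
qed

text \<open>Lag and displacement are divided into \<open>N\<close> equal parts, so that every part
  satisfies the bounds of \<open>B_step\<close>.\<close>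

lemma B_steps:
  assumes l: "l > 0" and T: "real N * ((1 + \<gamma>) * l powr p) \<le> T" "T \<le> real N * (3 / 2 * (1 + \<gamma>) * l powr p)"
    and x: "\<And>i. \<bar>x' $ i - x $ i\<bar> \<le> real N * (l / 8)"
  shows "\<mu> (B x t l) \<le> c ^ N * \<mu> (B x' (t + T) l)"
  using T x
proof (induction N arbitrary: x t T)
  case 0
  then have "x' = x" "T = 0" by (auto simp: vec_eq_iff)
  then show ?case by simp
next
  case (Suc N)
  define T1 where "T1 = T / real (Suc N)"
  define x1 where "x1 = x + (1 / real (Suc N)) *\<^sub>R (x' - x)"
  have T_eq: "T = real (Suc N) * T1" by (simp add: T1_def)
  have T1: "(1 + \<gamma>) * l powr p \<le> T1" "T1 \<le> 3 / 2 * (1 + \<gamma>) * l powr p"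
    using Suc.prems(1,2) unfolding T_eq by (simp_all only: mult_le_cancel_left_pos of_nat_0_less_iff zero_less_Suc)
  have x1_eq: "x' $ i - x $ i = real (Suc N) * (x1 $ i - x $ i)" for i by (simp add: x1_def)
  then have x1_eq': "x' $ i - x1 $ i = real N * (x1 $ i - x $ i)" for i
    using x1_eq[of i] by (simp add: algebra_simps)
  have x1: "\<bar>x1 $ i - x $ i\<bar> \<le> l / 8" for i
    using Suc.prems(3)[of i] unfolding x1_eq abs_mult by (simp only: abs_of_nat mult_le_cancel_left_pos of_nat_0_less_iff zero_less_Suc)
  have "\<mu> (B x t l) \<le> c * \<mu> (B x1 (t + T1) l)" by (rule B_step[OF l T1 x1])
  also have "\<mu> (B x1 (t + T1) l) \<le> c ^ N * \<mu> (B x' (t + T1 + real N * T1) l)"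
  proof (rule Suc.IH)
    show "\<bar>x' $ i - x1 $ i\<bar> \<le> real N * (l / 8)" for i
      using x1[of i] unfolding x1_eq' abs_mult by (simp only: abs_of_nat mult_left_mono of_nat_0_le_iff)
  qed (intro mult_left_mono T1 of_nat_0_le_iff)+
  also have "t + T1 + real N * T1 = t + T" by (simp add: T_eq algebra_simps)
  finally show ?case using c_ge_1 by (simp add: mult.assoc mult_left_mono)
qed

text \<open>The number of steps is the integer part \<open>N\<close> of
  \<open>T / ((1 + \<gamma>) * l powr p)\<close>. As \<open>N\<close> is at least 2, rounding costs
  at most the factor 3/2 allowed per step. For fixed \<open>T\<close> the reach
  \<open>T / l powr p * l / 32\<close> grows without bound as \<open>l\<close> tends to 0, because
  \<open>p > 1\<close>.\<close>

lemma B_chain: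
  assumes l: "l > 0" and T: "2 * (1 + \<gamma>) * l powr p \<le> T" "T \<le> real H * l powr p"
    and x: "\<And>i. \<bar>x' $ i - x $ i\<bar> \<le> T / l powr p * l / 32"
  shows "\<mu> (B x t l) \<le> c ^ H * \<mu> (B x' (t + T) l)"
proof -
  define r where "r = T / ((1 + \<gamma>) * l powr p)"
  define N where "N = nat \<lfloor>r\<rfloor>"
  have g: "1 + \<gamma> > 0" "l powr p > 0" using \<gamma>_pos l by auto
  have T_eq: "T = r * ((1 + \<gamma>) * l powr p)" using g by (simp add: r_def)
  have r2: "2 \<le> r" using T(1) g unfolding r_def by (subst pos_le_divide_eq) (simp_all only: mult_pos_pos mult.assoc)
  have N: "real N \<le> r" "r \<le> real N + 1" "2 \<le> N" using r2 by (auto simp: N_def le_nat_floor)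
  have "T / l powr p = r * (1 + \<gamma>)" using g by (simp add: T_eq)
  also have "\<dots> \<le> r * 2" using r2 \<gamma>_less_1 by (intro mult_left_mono) auto
  finally have Tl: "T / l powr p \<le> r * 2" .
  have "real N \<le> real H"
  proof -
    have "r * 1 \<le> r * (1 + \<gamma>)" using r2 \<gamma>_pos by (intro mult_left_mono) auto
    also have "\<dots> = T / l powr p" using g by (simp add: T_eq)
    also have "\<dots> \<le> real H" using T(2) g by (simp add: field_simps)
    finally show ?thesis using N(1) by simp
  qed
  then have "c ^ N \<le> c ^ H" using c_ge_1 by (intro power_increasing) auto
  have "\<mu> (B x t l) \<le> c ^ N * \<mu> (B x' (t + T) l)"
  proof (rule B_steps[OF l])
    show "real N * ((1 + \<gamma>) * l powr p) \<le> T"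
      unfolding T_eq using N(1) g by (intro mult_right_mono) auto
    have "r \<le> real N * (3 / 2)" using N by linarith
    then have "T \<le> real N * (3 / 2) * ((1 + \<gamma>) * l powr p)"
      unfolding T_eq using g by (intro mult_right_mono) auto
    then show "T \<le> real N * (3 / 2 * (1 + \<gamma>) * l powr p)" by (simp only: mult.assoc)
    \<comment> \<open>\<open>T / l powr p\<close> is at most \<open>2 * r\<close>, hence at most
      \<open>4 * N\<close>; the divisor 32 leaves \<open>l / 8\<close> per step.\<close>
    show "\<bar>x' $ i - x $ i\<bar> \<le> real N * (l / 8)" for i
    proof -
      have "\<bar>x' $ i - x $ i\<bar> \<le> (T / l powr p) * (l / 32)" using x[of i] by simp
      also have "\<dots> \<le> (4 * real N) * (l / 32)"
        using Tl N l by (intro mult_right_mono) linarith+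
      finally show ?thesis by (simp add: mult.commute)
    qed
  qed
  also have "\<dots> \<le> c ^ H * \<mu> (B x' (t + T) l)"
    using \<open>c ^ N \<le> c ^ H\<close> by (intro mult_right_mono) auto
  finally show ?thesis .
qed

lemma B_subset_D: "l > 0 \<Longrightarrow> B x (v + l powr p / 2) l \<subseteq> D x v l"
  unfolding B_def D_def using \<gamma>_pos powr_ge_zero[of l p]
  by (intro pbox_mono) (simp_all add: field_simps)

lemma \<mu>_finite_cover:
  assumes "finite J" "A \<subseteq> (\<Union>j\<in>J. B (X j) (S j) l)" "A \<in> sets lebesgue"
    and "\<And>j. j \<in> J \<Longrightarrow> \<mu> (B (X j) (S j) l) \<le> m"
  shows "\<mu> A \<le> real (card J) * m"
proof -
  have fm: "B (X j) (S j) l \<in> fmeasurable (wmeas w)" for j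
    unfolding B_def by (intro wmeas_fmeasurable weight pbox_sets_lebesgue bounded_pbox)
  have "\<mu> A \<le> \<mu> (\<Union>j\<in>J. B (X j) (S j) l)"
    using assms(1-3) fm by (intro measure_mono_fmeasurable fmeasurable.finite_UN) auto
  also have "\<dots> \<le> (\<Sum>j\<in>J. \<mu> (B (X j) (S j) l))"
    using assms(1) by (intro measure_UNION_le) (auto simp: B_def)
  also have "\<dots> \<le> (\<Sum>j\<in>J. m)" using assms(4) by (intro sum_mono)
  finally show ?thesis by simp
qed

text \<open>Boxes \<open>B\<close> stacked in time cover the larger box; one doubling halves their
  side, and a chain carries each into \<open>D x v l\<close>. The lower bound on
  \<open>v - u\<close> pays for the height of the larger box, the lag of the doubling and the
  minimal lag of a chain.\<close>

lemma D_step: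
  "\<exists>C\<ge>1. \<forall>x u v l. l > 0 \<longrightarrow> (3 * 2 powr p + 4) * l powr p \<le> v - u \<longrightarrow>
     v - u \<le> 11 * 2 powr p * l powr p \<longrightarrow> \<mu> (D x u (2 * l)) \<le> C * \<mu> (D x v l)"
proof -
  define a where "a = (1 - \<gamma>) / 2"
  have a: "0 < a" "a < 1" using \<gamma>_pos \<gamma>_less_1 by (auto simp: a_def)
  define J where "J = {j::nat. real j * a \<le> 1}"
  have "j \<le> nat \<lceil>1 / a\<rceil>" if "real j * a \<le> 1" for j
  proof -
    have "real j \<le> 1 / a" using a that by (simp add: pos_le_divide_eq)
    also have "\<dots> \<le> real (nat \<lceil>1 / a\<rceil>)" by (rule real_nat_ceiling_ge)
    finally show ?thesis by simp
  qed
  then have "J \<subseteq> {..nat \<lceil>1 / a\<rceil>}" by (auto simp: J_def)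
  then have fJ: "finite J" by (rule finite_subset) simp
  define H where "H = nat \<lceil>11 * 2 powr p + 1\<rceil>"
  have H: "11 * 2 powr p + 1 \<le> real H" unfolding H_def by (rule real_nat_ceiling_ge)
  have "\<mu> (D x u (2 * l)) \<le> real (card J) * (c * (c ^ H * \<mu> (D x v l)))"
    if l: "l > 0" and vu: "(3 * 2 powr p + 4) * l powr p \<le> v - u" "v - u \<le> 11 * 2 powr p * l powr p"
    for x u v l
  proof -
    define P where "P = (2 * l) powr p"
    have P: "P = 2 powr p * l powr p" "P > 0" using l by (auto simp: P_def powr_mult)
    have lp: "l powr p > 0" using l by simp
    \<comment> \<open>Successive centres are half the height of a box apart, so the boxes overlap
      and no point of the open time interval is missed.\<close>
    define S where "S j = u + real j * a * P" for j
    show ?thesis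
    proof (rule \<mu>_finite_cover[OF fJ, where X = "\<lambda>_. x" and S = S and l = "2 * l"])
      have "\<exists>j\<in>J. \<tau> \<in> {S j - a * P <..< S j + a * P}" if \<tau>: "u < \<tau>" "\<tau> < u + P" for \<tau>
      proof -
        define y where "y = (\<tau> - u) / (a * P)"
        define j where "j = nat \<lfloor>y\<rfloor>"
        have \<tau>_eq: "\<tau> = u + y * (a * P)" using a P(2) by (simp add: y_def)
        have y0: "0 < y" using \<tau> a P(2) by (simp add: y_def)
        then have j: "real j \<le> y" "y < real j + 1" by (auto simp: j_def)
        have "y * a * P < 1 * P" using \<tau> by (simp add: \<tau>_eq mult.assoc)
        then have "y * a < 1" using P(2) by (simp only: mult_less_cancel_right_pos)
        moreover have "real j * a \<le> y * a" using j a by (intro mult_right_mono) auto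
        ultimately have "j \<in> J" by (simp add: J_def)
        moreover have "(real j - 1) * (a * P) < y * (a * P)" "y * (a * P) < (real j + 1) * (a * P)"
          using j a P by (auto intro!: mult_strict_right_mono)
        then have "\<tau> \<in> {S j - a * P <..< S j + a * P}"
          by (auto simp: \<tau>_eq S_def algebra_simps)
        ultimately show ?thesis by blast
      qed
      then show "D x u (2 * l) \<subseteq> (\<Union>j\<in>J. B x (S j) (2 * l))"
        by (fastforce simp: D_def B_def pbox_def P_def[symmetric] a_def[symmetric])
      show "D x u (2 * l) \<in> sets lebesgue" by (simp add: D_def)
      fix j assume "j \<in> J"
      then have "real j * a * P \<le> 1 * P" using P(2) by (intro mult_right_mono) (auto simp: J_def)
      then have S: "u \<le> S j" "S j \<le> u + P" using a P by (auto simp: S_def)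
      \<comment> \<open>The lag from the halved box to the midpoint in time of
        \<open>D x v l\<close>.\<close>
      define T where "T = v + l powr p / 2 - (S j + (1 + \<gamma>) * P)"
      have gP: "\<gamma> * P \<le> P" "0 \<le> \<gamma> * P" "\<gamma> * l powr p \<le> l powr p"
        using \<gamma>_pos \<gamma>_less_1 P(2) lp by (simp_all add: mult_left_le_one_le)
      have T: "2 * (1 + \<gamma>) * l powr p \<le> T" "T \<le> (11 * 2 powr p + 1) * l powr p"
      proof -
        have "3 * P + 4 * l powr p \<le> v - u" "v - u \<le> 11 * P"
          using vu by (simp_all add: P algebra_simps)
        moreover have "(1 + \<gamma>) * P = P + \<gamma> * P" "2 * (1 + \<gamma>) * l powr p = 2 * l powr p + 2 * (\<gamma> * l powr p)"
          "(11 * 2 powr p + 1) * l powr p = 11 * P + l powr p"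
          by (simp_all add: P algebra_simps)
        ultimately show "2 * (1 + \<gamma>) * l powr p \<le> T" "T \<le> (11 * 2 powr p + 1) * l powr p"
          using S gP lp P(2) unfolding T_def by linarith+
      qed
      have "\<mu> (B x (S j) (2 * l)) \<le> c * \<mu> (B x (S j + (1 + \<gamma>) * P) l)"
        using doubling_B[of "2 * l" x "S j"] l by (simp add: P_def)
      also have "\<mu> (B x (S j + (1 + \<gamma>) * P) l) \<le> c ^ H * \<mu> (B x (S j + (1 + \<gamma>) * P + T) l)"
      proof (rule B_chain[OF l T(1)])
        show "T \<le> real H * l powr p"
          using T(2) H lp by (meson mult_right_mono less_imp_le order_trans)
        have "T \<ge> 0" using T(1) lp \<gamma>_pos by (smt (verit) mult_nonneg_nonneg)
        then show "\<bar>x $ i - x $ i\<bar> \<le> T / l powr p * l / 32" for i using lp l by simp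
      qed
      also have "B x (S j + (1 + \<gamma>) * P + T) l \<subseteq> D x v l"
        using B_subset_D[OF l, of x v] by (simp add: T_def)
      then have "\<mu> (B x (S j + (1 + \<gamma>) * P + T) l) \<le> \<mu> (D x v l)"
        unfolding D_def by (intro \<mu>_pbox_mono) (auto simp: B_def)
      finally show "\<mu> (B x (S j) (2 * l)) \<le> c * (c ^ H * \<mu> (D x v l))"
        using c_ge_1 by (simp add: mult_left_mono)
    qed
  qed
  moreover have "1 \<le> real (card J) * (c * c ^ H)"
  proof -
    have "0 \<in> J" by (simp add: J_def)
    then have "1 \<le> card J" using fJ by (metis One_nat_def Suc_leI card_gt_0_iff empty_iff)
    moreover have "1 \<le> c ^ Suc H" using c_ge_1 by (rule one_le_power)
    ultimately show ?thesis
      by (metis mult_mono' mult_1 of_nat_1 of_nat_le_iff power_Suc zero_le_one)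
  qed
  ultimately show ?thesis
    by (intro exI[of _ "real (card J) * (c * c ^ H)"]) (auto simp: mult.assoc)
qed

text \<open>A fixed number of boxes \<open>B\<close> of side \<open>\<sigma> * L\<close> covers the
  lower rectangle, and each is chained into the box \<open>D\<close> before \<open>(x, t)\<close>.
  Smallness of \<open>\<sigma>\<close> keeps the lag at least \<open>\<gamma> / 4 * L powr p\<close>
  (constant 42) and lets this lag bridge the spatial distance (constant 192). The range of
  \<open>(x, t)\<close> is large enough for the enlarged upper rectangle used later.\<close>

lemma initial_box:
  assumes \<sigma>: "0 < \<sigma>" "\<sigma> \<le> 1" "42 * \<sigma> powr p \<le> \<gamma>" "192 * \<sigma> powr (p - 1) \<le> \<gamma>"
  shows "\<exists>C\<ge>1. \<forall>x0 t0 L x t. L > 0 \<longrightarrow> (\<forall>i. \<bar>x $ i - x0 $ i\<bar> \<le> L) \<longrightarrow>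
    t0 + \<gamma> / 2 * L powr p \<le> t \<longrightarrow> t \<le> t0 + L powr p \<longrightarrow>
    \<mu> (pbox x0 L (t0 - L powr p) (t0 - \<gamma> * L powr p)) \<le>
      C * \<mu> (D x (t - 11 * (\<sigma> * L) powr p) (\<sigma> * L))"
proof -
  define \<tau> where "\<tau> = (1 - \<gamma>) / 2 * \<sigma> powr p"
  have "\<tau> > 0" using \<sigma> \<gamma>_less_1 by (simp add: \<tau>_def)
  then obtain F where F: "F \<subseteq> cube (0::real^'n) 1 \<times> {0..1::real}" "finite F"
    "cube 0 1 \<times> {0..1} \<subseteq> (\<Union>z\<in>F. pbox (fst z) \<sigma> (snd z - \<tau>) (snd z + \<tau>))"
    using unit_box_finite_cover[OF \<sigma>(1)] by blast
  \<comment> \<open>The lag will be at most \<open>2 * L powr p\<close>, which is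
    \<open>2 / \<sigma> powr p\<close> units of \<open>(\<sigma> * L) powr p\<close>.\<close>
  define H where "H = nat \<lceil>2 / \<sigma> powr p\<rceil>"
  have H: "2 / \<sigma> powr p \<le> real H" unfolding H_def by (rule real_nat_ceiling_ge)
  have "\<mu> (pbox x0 L (t0 - L powr p) (t0 - \<gamma> * L powr p)) \<le>
      real (card F) * (c ^ H * \<mu> (D x (t - 11 * (\<sigma> * L) powr p) (\<sigma> * L)))"
    if L: "L > 0" and x: "\<And>i. \<bar>x $ i - x0 $ i\<bar> \<le> L"
      and t: "t0 + \<gamma> / 2 * L powr p \<le> t" "t \<le> t0 + L powr p" for x0 t0 L x t
  proof (rule \<mu>_finite_cover[OF F(2)])
    define P where "P = L powr p"
    have P: "P > 0" using L by (simp add: P_def)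
    define l where "l = \<sigma> * L"
    have l: "l > 0" using L \<sigma> by (simp add: l_def)
    have lp: "l powr p = \<sigma> powr p * P" using L \<sigma> by (simp add: l_def P_def powr_mult)
    have sp: "\<sigma> powr p > 0" using \<sigma> by simp
    let ?X = "\<lambda>z. x0 + L *\<^sub>R fst z :: real^'n" and ?S = "\<lambda>z::(real^'n) \<times> real. t0 - P + P * snd z"
    show "pbox x0 L (t0 - L powr p) (t0 - \<gamma> * L powr p) \<subseteq> (\<Union>z\<in>F. B (?X z) (?S z) (\<sigma> * L))"
    proof
      fix y assume y: "y \<in> pbox x0 L (t0 - L powr p) (t0 - \<gamma> * L powr p)"
      define y' where "y' = ((1 / L) *\<^sub>R (fst y - x0), (snd y - (t0 - P)) / P)"
      have y_eq: "fst y = x0 + L *\<^sub>R fst y'" "snd y = t0 - P + P * snd y'"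
        using L P by (auto simp: y'_def)
      have "y' \<in> cube 0 1 \<times> {0..1}"
      proof -
        have "\<bar>fst y' $ i\<bar> \<le> 1 / 2" for i
        proof -
          have "\<bar>L * fst y' $ i\<bar> \<le> L / 2" using y by (auto simp: pbox_def cube_def y_eq mem_Times_iff)
          then show ?thesis using L by (simp add: abs_mult field_simps)
        qed
        moreover have "0 \<le> \<gamma> * P" using \<gamma>_pos P by simp
        then have "snd y' \<in> {0..1}" using y P
          by (auto simp: pbox_def y'_def P_def[symmetric] mem_Times_iff field_simps)
        ultimately show ?thesis by (auto simp: cube_def mem_Times_iff)
      qed
      then obtain z where z: "z \<in> F" "y' \<in> pbox (fst z) \<sigma> (snd z - \<tau>) (snd z + \<tau>)"
        using F(3) by blast
      have "\<bar>fst y $ i - ?X z $ i\<bar> \<le> \<sigma> * L / 2" for i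
      proof -
        have "L * \<bar>fst y' $ i - fst z $ i\<bar> \<le> L * (\<sigma> / 2)"
          using z(2) L by (intro mult_left_mono) (auto simp: pbox_def cube_def mem_Times_iff)
        moreover have "fst y $ i - ?X z $ i = L * (fst y' $ i - fst z $ i)"
          by (simp add: y_eq algebra_simps)
        ultimately show ?thesis using L by (simp only: abs_mult abs_of_pos mult.commute[of \<sigma>] times_divide_eq_right)
      qed
      moreover have "P * (snd z - \<tau>) < P * snd y'" "P * snd y' < P * (snd z + \<tau>)"
        using z(2) P by (auto simp: pbox_def mem_Times_iff)
      then have "snd y \<in> {?S z - P * \<tau> <..< ?S z + P * \<tau>}"
        by (auto simp: y_eq algebra_simps)
      moreover have "P * \<tau> = (1 - \<gamma>) / 2 * (\<sigma> * L) powr p"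
        using lp by (simp add: \<tau>_def l_def)
      ultimately have "y \<in> B (?X z) (?S z) (\<sigma> * L)"
        by (auto simp: B_def pbox_def cube_def mem_Times_iff)
      then show "y \<in> (\<Union>z\<in>F. B (?X z) (?S z) (\<sigma> * L))" using z(1) by blast
    qed
    show "pbox x0 L (t0 - L powr p) (t0 - \<gamma> * L powr p) \<in> sets lebesgue" by simp
    fix z assume "z \<in> F"
    then have z: "\<bar>fst z $ i\<bar> \<le> 1 / 2" "0 \<le> snd z" "snd z \<le> 1" for i
      using F(1) by (auto simp: cube_def)
    define v where "v = t - 11 * l powr p"
    define T where "T = v + l powr p / 2 - ?S z"
    have S: "t0 - P \<le> ?S z" "?S z \<le> t0" using z P by (auto simp: mult_left_le)
    have s42: "42 * (\<sigma> powr p * P) \<le> \<gamma> * P" using \<sigma>(3) P by (simp flip: mult.assoc)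
    \<comment> \<open>The midpoint of the target box lies 10.5 units \<open>l powr p\<close> before
      \<open>t\<close>; as 42 is four times 10.5, this costs at most
      \<open>\<gamma> / 4 * P\<close>.\<close>
    have T: "\<gamma> / 4 * P \<le> T" "T \<le> 2 * P"
      
    proof -
      have "t0 + \<gamma> / 2 * P \<le> t" "t \<le> t0 + P" using t by (simp_all add: P_def)
      moreover have "0 \<le> \<sigma> powr p * P" using sp P by simp
      ultimately show "\<gamma> / 4 * P \<le> T" "T \<le> 2 * P"
        using S s42 unfolding T_def v_def lp by linarith+
    qed
    have "\<mu> (B (?X z) (?S z) l) \<le> c ^ H * \<mu> (B x (?S z + T) l)"
    proof (rule B_chain[OF l])
      have "(1 + \<gamma>) * (\<sigma> powr p * P) \<le> 2 * (\<sigma> powr p * P)"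
        using \<gamma>_less_1 sp P by (intro mult_right_mono) auto
      moreover have "0 \<le> \<sigma> powr p * P" using sp P by simp
      ultimately have "2 * (1 + \<gamma>) * (\<sigma> powr p * P) \<le> \<gamma> / 4 * P"
        using s42 by linarith
      then show "2 * (1 + \<gamma>) * l powr p \<le> T" using T(1) unfolding lp by linarith
      have "T \<le> (2 / \<sigma> powr p) * (\<sigma> powr p * P)" using T(2) sp by simp
      also have "\<dots> \<le> real H * (\<sigma> powr p * P)" using H sp P by (intro mult_right_mono) auto
      finally show "T \<le> real H * l powr p" unfolding lp .
      fix i
      have "\<bar>L * fst z $ i\<bar> \<le> L / 2" using z(1)[of i] L by (simp add: abs_mult field_simps)
      moreover have "x $ i - ?X z $ i = (x $ i - x0 $ i) - L * fst z $ i" by simp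
      ultimately have "\<bar>x $ i - ?X z $ i\<bar> \<le> 3 / 2 * L" using x[of i] by linarith
      \<comment> \<open>A chain of lag \<open>\<gamma> / 4 * P\<close> reaches as far as
        \<open>\<gamma> / (128 * \<sigma> powr (p - 1)) * L\<close>, and 192 is 3/2 times
        128.\<close>
      also have "\<dots> \<le> (\<gamma> / 4 * P) / l powr p * l / 32"
      proof -
        have "\<sigma> powr p = \<sigma> powr (p - 1) * \<sigma>" using \<sigma> by (simp add: powr_diff)
        then have "(\<gamma> / 4 * P) / l powr p * l / 32 = \<gamma> / (128 * \<sigma> powr (p - 1)) * L"
          using \<sigma>(1) P unfolding lp unfolding l_def by (simp add: field_simps)
        moreover have "3 / 2 \<le> \<gamma> / (128 * \<sigma> powr (p - 1))" using \<sigma> by (simp add: field_simps)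
        ultimately show ?thesis using L by (simp only: mult_right_mono less_imp_le)
      qed
      also have "\<dots> \<le> T / l powr p * l / 32"
        using T(1) l by (intro divide_right_mono mult_right_mono) auto
      finally show "\<bar>x $ i - ?X z $ i\<bar> \<le> T / l powr p * l / 32" .
    qed
    also have "\<mu> (B x (?S z + T) l) \<le> \<mu> (D x v l)"
      using B_subset_D[OF l, of x v] unfolding D_def by (intro \<mu>_pbox_mono) (auto simp: B_def T_def)
    finally show "\<mu> (B (?X z) (?S z) (\<sigma> * L)) \<le> c ^ H * \<mu> (D x (t - 11 * (\<sigma> * L) powr p) (\<sigma> * L))"
      using c_ge_1 by (simp add: l_def v_def mult_left_mono)
  qed
  moreover have "1 \<le> real (card F) * c ^ H"
  proof -
    have "(0, 0) \<in> cube (0::real^'n) 1 \<times> {0..1::real}" by (simp add: cube_def)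
    then have "F \<noteq> {}" using F(3) by blast
    then have "1 \<le> card F" using F(2) by (metis One_nat_def Suc_leI card_gt_0_iff)
    moreover have "1 \<le> c ^ H" using c_ge_1 by (rule one_le_power)
    ultimately show ?thesis by (metis mult_mono' mult_1 of_nat_1 of_nat_le_iff zero_le_one)
  qed
  ultimately show ?thesis
    by (intro exI[of _ "real (card F) * c ^ H"]) (auto simp: mult.assoc)
qed

section \<open>Lebesgue volume, and boxes in the past of a point\<close>

lemma D_sets [measurable]: "D x u l \<in> sets lebesgue"
  by (simp add: D_def)

lemma w_nonneg: "0 \<le> w z"
  using weight unfolding weight_def by blast

lemma w_measurable [measurable]: "w \<in> borel_measurable lebesgue"
  by (rule weight_measurable[OF weight])

definition vol :: "real \<Rightarrow> real" where
  "vol l = l ^ CARD('n) * l powr p"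

lemma vol_pos: "l > 0 \<Longrightarrow> vol l > 0" by (simp add: vol_def)

lemma vol_mono: "0 \<le> l \<Longrightarrow> l \<le> l' \<Longrightarrow> vol l \<le> vol l'"
  using p_gt_1 by (auto simp: vol_def intro!: mult_mono power_mono powr_mono2)

lemma emeasure_D: "l \<ge> 0 \<Longrightarrow> emeasure lebesgue (D x u l) = ennreal (vol l)"
  unfolding D_def by (subst emeasure_pbox) (simp_all add: vol_def)

lemma \<mu>_le_measure:
  assumes A: "A \<in> sets lebesgue" "bounded A" and s: "\<And>z. z \<in> A \<Longrightarrow> w z \<le> s" "0 \<le> s"
  shows "\<mu> A \<le> s * measure lebesgue A"
proof -
  have lm: "A \<in> lmeasurable" using A by (intro bounded_set_imp_lmeasurable)
  have "ennreal (\<mu> A) = (\<integral>\<^sup>+z\<in>A. ennreal (w z) \<partial>lebesgue)"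
    using wmeasure_eq_measure[OF weight A] by (simp add: wmeasure_def)
  also have "\<dots> \<le> (\<integral>\<^sup>+z. ennreal s * indicator A z \<partial>lebesgue)"
    using s by (intro nn_integral_mono) (auto simp: indicator_def ennreal_leI)
  also have "\<dots> = ennreal (s * measure lebesgue A)"
    using A lm s(2) by (simp add: nn_integral_cmult_indicator emeasure_eq_measure2 ennreal_mult)
  finally show ?thesis using s(2) by simp
qed

text \<open>A lag of 11 suffices: with \<open>P = 2\<^sup>p \<ge> 2\<close>, both \<open>11 P - 12\<close> and \<open>11 P - 11\<close> lie between
  \<open>3 P + 4\<close> and \<open>11 P\<close>, the range of time lags allowed in \<open>D_step\<close>.\<close>

lemma D_past:
  "\<exists>C\<ge>1. \<forall>x t l. l > 0 \<longrightarrow>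
    \<mu> (D x (t - 11 * (2 * l) powr p) (2 * l)) \<le> C * \<mu> (D x (t - 12 * l powr p) l) \<and>
    \<mu> (D x (t - 11 * (2 * l) powr p) (2 * l)) \<le> C * \<mu> (D x (t - 11 * l powr p) l)"
proof -
  obtain C where C: "C \<ge> 1" "\<And>x u v l. l > 0 \<Longrightarrow> (3 * 2 powr p + 4) * l powr p \<le> v - u \<Longrightarrow>
     v - u \<le> 11 * 2 powr p * l powr p \<Longrightarrow> \<mu> (D x u (2 * l)) \<le> C * \<mu> (D x v l)"
    using D_step by blast
  have *: "\<mu> (D x (t - 11 * (2 * l) powr p) (2 * l)) \<le> C * \<mu> (D x (t - k * l powr p) l)"
    if l: "l > 0" and k: "k = 11 \<or> k = 12" for x t l k
  proof (rule C(2)[OF l])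
    have P: "2 * l powr p \<le> 2 powr p * l powr p"
      using le_powr_p[of 2] by (intro mult_right_mono) auto
    have e: "(2 * l) powr p = 2 powr p * l powr p" using l by (simp add: powr_mult)
    show "(3 * 2 powr p + 4) * l powr p \<le> t - k * l powr p - (t - 11 * (2 * l) powr p)"
      unfolding e distrib_right mult.assoc using k P powr_ge_zero[of l p] by (elim disjE; hypsubst; linarith)
    show "t - k * l powr p - (t - 11 * (2 * l) powr p) \<le> 11 * 2 powr p * l powr p"
      unfolding e using k powr_ge_zero[of l p] by auto
  qed
  show ?thesis using C(1) * by blast
qed

end

subsection \<open>Decay of the sublevel sets\<close>

text \<open>\<open>RH\<close> is the reverse Hoelder inequality raised to the power \<open>q\<close>
  and multiplied by the volume; the two boxes adjoin at time \<open>u + l powr p\<close>.\<close>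

locale parabolic_RH_weight = forward_doubling_weight w p \<gamma> c
  for w :: "(real^'n::finite) \<times> real \<Rightarrow> real" and p \<gamma> c +
  fixes q K0 :: real
  assumes q_gt_1: "1 < q" and K0: "0 < K0"
    and RH: "l > 0 \<Longrightarrow> (\<integral>\<^sup>+z\<in>D x u l. ennreal (w z powr q) \<partial>lebesgue) \<le>
      ennreal (vol l * (K0 * (\<mu> (D x (u + l powr p) l) / vol l)) powr q)"
begin

text \<open>A Paley--Zygmund argument: where the mean of the weight over a box and over its future are
  comparable, the reverse Hoelder inequality forces the weight to be comparable to its mean on a
  fixed proportion of the box.\<close>

lemma comparable_proportion:
  assumes l: "l > 0" and \<tau>: "\<tau> > 0" and \<delta>: "0 < \<delta>"
    and K: "1 \<le> K" "K0 powr q * K powr (1 - q) \<le> \<delta> / 4"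
    and high: "\<delta> * \<tau> * vol l \<le> \<mu> (D x u l)"
    and low: "\<mu> (D x (u + l powr p) l) \<le> \<tau> * vol l"
  shows "\<delta> / (2 * K) * vol l \<le> measure lebesgue {z\<in>D x u l. \<delta> / 4 * \<tau> \<le> w z \<and> w z < K * \<tau>}"
proof -
  define A where "A = D x u l"
  define T where "T = {z\<in>A. \<delta> / 4 * \<tau> \<le> w z \<and> w z < K * \<tau>}"
  have A[measurable]: "A \<in> sets lebesgue" by (simp add: A_def)
  have T_set[measurable]: "T \<in> sets lebesgue"
  proof -
    have "T = A \<inter> {z\<in>space lebesgue. \<delta> / 4 * \<tau> \<le> w z \<and> w z < K * \<tau>}" by (auto simp: T_def)
    also have "\<dots> \<in> sets lebesgue" by measurable
    finally show ?thesis .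
  qed
  have bA: "bounded A" by (simp add: A_def D_def bounded_pbox)
  have lmT: "T \<in> lmeasurable"
    using bounded_subset[OF bA, of T] by (intro bounded_set_imp_lmeasurable) (auto simp: T_def)
  have v: "vol l > 0" by (rule vol_pos[OF l])
  have K\<tau>: "K * \<tau> > 0" using K \<tau> by simp
  \<comment> \<open>Values above \<open>K * \<tau>\<close> are estimated by
    \<open>w z powr q\<close>, with the factor \<open>(K * \<tau>) powr (1 - q)\<close> coming from
    \<open>q > 1\<close>.\<close>
  have pw: "ennreal (w z) * indicator A z \<le> ennreal (\<delta> / 4 * \<tau>) * indicator A z +
      ennreal ((K * \<tau>) powr (1 - q)) * (ennreal (w z powr q) * indicator A z) +
      ennreal (K * \<tau>) * indicator T z" for z
  proof (cases "z \<in> A")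
    case zA: True
    consider "w z < \<delta> / 4 * \<tau>" | "z \<in> T" | "K * \<tau> \<le> w z" using zA unfolding T_def mem_Collect_eq by linarith
    then show ?thesis
    proof cases
      case 1
      then have "ennreal (w z) \<le> ennreal (\<delta> / 4 * \<tau>)" by (intro ennreal_leI) auto
      then show ?thesis using zA by (simp add: add_increasing2)
    next
      case 2
      then have "ennreal (w z) \<le> ennreal (K * \<tau>)" by (intro ennreal_leI) (auto simp: T_def)
      then show ?thesis using zA 2 by (simp add: add_increasing)
    next
      case 3
      have "w z = (w z) powr (1 - q) * w z powr q"
        using 3 K\<tau> by (simp flip: powr_add)
      also have "\<dots> \<le> (K * \<tau>) powr (1 - q) * w z powr q"
        using 3 K\<tau> q_gt_1 by (intro mult_right_mono powr_mono2') auto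
      finally have "ennreal (w z) \<le> ennreal ((K * \<tau>) powr (1 - q)) * ennreal (w z powr q)"
        by (simp flip: ennreal_mult add: ennreal_leI)
      then show ?thesis using zA by (simp add: add_increasing add_increasing2)
    qed
  qed simp
  have q_int: "(\<integral>\<^sup>+z\<in>A. ennreal (w z powr q) \<partial>lebesgue) \<le> ennreal (vol l * (K0 * \<tau>) powr q)"
  proof -
    have "K0 * (\<mu> (D x (u + l powr p) l) / vol l) \<le> K0 * \<tau>"
      using low v K0 by (intro mult_left_mono) (auto simp: field_simps)
    then have "(K0 * (\<mu> (D x (u + l powr p) l) / vol l)) powr q \<le> (K0 * \<tau>) powr q"
      using K0 v q_gt_1 by (intro powr_mono2) auto
    then show ?thesis
      unfolding A_def using v by (intro order_trans[OF RH[OF l]] ennreal_leI mult_left_mono) auto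
  qed
  have "ennreal (\<mu> A) = (\<integral>\<^sup>+z. ennreal (w z) * indicator A z \<partial>lebesgue)"
    using wmeasure_eq_measure[OF weight A bA] by (simp add: wmeasure_def)
  also have "\<dots> \<le> (\<integral>\<^sup>+z. ennreal (\<delta> / 4 * \<tau>) * indicator A z +
      ennreal ((K * \<tau>) powr (1 - q)) * (ennreal (w z powr q) * indicator A z) +
      ennreal (K * \<tau>) * indicator T z \<partial>lebesgue)"
    by (intro nn_integral_mono pw)
  also have "\<dots> = ennreal (\<delta> / 4 * \<tau>) * emeasure lebesgue A +
      ennreal ((K * \<tau>) powr (1 - q)) * (\<integral>\<^sup>+z\<in>A. ennreal (w z powr q) \<partial>lebesgue) +
      ennreal (K * \<tau>) * emeasure lebesgue T"
    by (simp add: nn_integral_add nn_integral_cmult nn_integral_cmult_indicator)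
  also have "\<dots> \<le> ennreal (\<delta> / 4 * \<tau>) * ennreal (vol l) +
      ennreal ((K * \<tau>) powr (1 - q)) * ennreal (vol l * (K0 * \<tau>) powr q) +
      ennreal (K * \<tau>) * ennreal (measure lebesgue T)"
    using l lmT q_int unfolding A_def
    by (intro add_mono mult_left_mono) (auto simp: emeasure_D[of l x u, unfolded A_def] emeasure_eq_measure2 simp del: emeasure_completion)
  also have "\<dots> = ennreal (\<delta> / 4 * \<tau> * vol l + (K * \<tau>) powr (1 - q) * (vol l * (K0 * \<tau>) powr q)
      + K * \<tau> * measure lebesgue T)"
    using \<delta> \<tau> v K\<tau> by (simp flip: ennreal_mult ennreal_plus)
  finally have "\<mu> A \<le> \<delta> / 4 * \<tau> * vol l + (K * \<tau>) powr (1 - q) * (vol l * (K0 * \<tau>) powr q)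
      + K * \<tau> * measure lebesgue T"
    using \<delta> \<tau> v K\<tau> by (subst (asm) ennreal_le_iff) auto
  also have "(K * \<tau>) powr (1 - q) * (vol l * (K0 * \<tau>) powr q) = (K0 powr q * K powr (1 - q)) * (\<tau> * vol l)"
  proof -
    have "\<tau> powr (1 - q) * \<tau> powr q = \<tau>" using \<tau> by (simp flip: powr_add)
    then show ?thesis using K \<tau> K0 by (simp add: powr_mult algebra_simps)
  qed
  \<comment> \<open>Low and high values contribute at most a quarter of
    \<open>\<delta> * \<tau> * vol l\<close> each, which leaves half of it for \<open>T\<close>,
    where \<open>w\<close> is below \<open>K * \<tau>\<close>.\<close>
  also have "\<dots> \<le> \<delta> / 4 * (\<tau> * vol l)" using K(2) \<tau> v by (intro mult_right_mono) auto
  finally have "\<delta> * (\<tau> * vol l) \<le> \<delta> / 2 * (\<tau> * vol l) + \<tau> * (K * measure lebesgue T)"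
    using high unfolding A_def by (simp add: algebra_simps)
  then have "\<tau> * (\<delta> / 2 * vol l) \<le> \<tau> * (K * measure lebesgue T)"
    by (simp add: algebra_simps)
  then have "\<delta> / 2 * vol l \<le> K * measure lebesgue T" using \<tau> by (simp only: mult_le_cancel_left_pos)
  then have "\<delta> / (2 * K) * vol l \<le> measure lebesgue T" using K by (simp add: field_simps)
  then show ?thesis by (simp add: T_def A_def)
qed

end

text \<open>One rectangle is fixed. The constants \<open>\<sigma>\<close>, \<open>C1\<close>,
  \<open>K\<close> will be chosen before it, whereas \<open>m0\<close> will be proportional to the
  mean of \<open>w\<close> over its lower part; \<open>initial\<close> makes \<open>m0\<close> a
  lower bound for the mean over the first past box.\<close>

locale level_set_decay = parabolic_RH_weight w p \<gamma> c q K0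
  for w :: "(real^'n::finite) \<times> real \<Rightarrow> real" and p \<gamma> c q K0 +
  fixes x0 :: "real^'n" and t0 L \<sigma> C1 K m0 :: real
  assumes L: "L > 0" and \<sigma>: "0 < \<sigma>" "24 * \<sigma> \<le> \<gamma>" and C1: "1 \<le> C1"
    and past12: "l > 0 \<Longrightarrow> \<mu> (D x (t - 11 * (2 * l) powr p) (2 * l)) \<le> C1 * \<mu> (D x (t - 12 * l powr p) l)"
    and past11: "l > 0 \<Longrightarrow> \<mu> (D x (t - 11 * (2 * l) powr p) (2 * l)) \<le> C1 * \<mu> (D x (t - 11 * l powr p) l)"
    and K: "1 \<le> K" "K0 powr q * K powr (1 - q) \<le> 1 / C1 / 4"
    and m0: "0 < m0"
    and initial: "(\<forall>i. \<bar>x $ i - x0 $ i\<bar> \<le> L) \<Longrightarrow> t0 + \<gamma> / 2 * L powr p \<le> t \<Longrightarrow> t \<le> t0 + L powr p \<Longrightarrow>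
      m0 * vol (\<sigma> * L) \<le> \<mu> (D x (t - 11 * (\<sigma> * L) powr p) (\<sigma> * L))"
begin

text \<open>The levels \<open>m k\<close> are so sparse that the values between \<open>1 / (4 C1)\<close> and \<open>K\<close> times the stopping
  level \<open>m k / K\<close> are exactly those between \<open>m (k + 1)\<close> and \<open>m k\<close>. The sets \<open>\<Omega> s\<close> interpolate
  between the upper rectangle (\<open>s = 0\<close>) and an enlargement of it (\<open>s = 1\<close>).\<close>

definition "\<Lambda> = 4 * C1 * K"

definition "m k = m0 / \<Lambda> ^ k"

definition "\<Omega> s = pbox x0 ((1 + s) * L) (t0 + \<gamma> * (1 - s / 2) * L powr p) (t0 + L powr p)"

text \<open>The domain shrinks towards the upper rectangle as the level falls, so that boxes stopped
  at points of \<open>E (Suc k)\<close> have room in the domain of \<open>E k\<close>.\<close>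

definition "E k = {z\<in>\<Omega> ((1 / 2) ^ k). w z < m k}"

definition "side j = \<sigma> * L / 2 ^ j"

text \<open>The box of the same size directly before this one has lag 12; it is the one on which the
  values of \<open>w\<close> will be compared with the level.\<close>

definition "past z l = D (fst z) (snd z - 11 * l powr p) l"

definition "low k z j \<longleftrightarrow> \<mu> (past z (side j)) < m k / K * vol (side j)"

lemma \<Lambda>_ge: "4 * C1 \<le> \<Lambda>" "4 * K \<le> \<Lambda>" "4 \<le> \<Lambda>" "\<Lambda> > 0"
proof -
  show a: "4 * C1 \<le> \<Lambda>" using K(1) C1 by (simp add: \<Lambda>_def mult_le_cancel_left1)
  show "4 * K \<le> \<Lambda>" using K(1) C1 by (simp add: \<Lambda>_def mult_le_cancel_right1)
  show "4 \<le> \<Lambda>" "\<Lambda> > 0" using a C1 by auto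
qed

lemma m_pos: "m k > 0" using m0 \<Lambda>_ge by (simp add: m_def)

lemma m_Suc: "m (Suc k) = 1 / C1 / 4 * (m k / K)"
  using \<Lambda>_ge C1 K(1) by (simp add: m_def \<Lambda>_def field_simps)

lemma side_pos: "side j > 0" using \<sigma> L by (simp add: side_def)

lemma side_0: "side 0 = \<sigma> * L" by (simp add: side_def)

lemma side_Suc: "side j = 2 * side (Suc j)" by (simp add: side_def)

lemma side_antimono: "j \<le> k \<Longrightarrow> side k \<le> side j"
  using \<sigma> L by (auto simp: side_def intro!: divide_left_mono power_increasing)

lemma \<sigma>_le_1: "\<sigma> \<le> 1" using \<sigma> \<gamma>_less_1 by simp

lemma \<Omega>_mono:
  assumes "0 \<le> s" "s \<le> s'"
  shows "\<Omega> s \<subseteq> \<Omega> s'"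
proof -
  have "\<gamma> * (1 - s' / 2) * L powr p \<le> \<gamma> * (1 - s / 2) * L powr p"
    using assms \<gamma>_pos by (intro mult_right_mono mult_left_mono) auto
  moreover have "s * L \<le> s' * L" using assms L by (intro mult_right_mono) auto
  ultimately show ?thesis unfolding \<Omega>_def by (intro pbox_mono) (auto simp: algebra_simps)
qed

lemma \<Omega>_sets [measurable]: "\<Omega> s \<in> sets lebesgue" by (simp add: \<Omega>_def)

lemma bounded_\<Omega>: "bounded (\<Omega> s)" by (simp add: \<Omega>_def bounded_pbox)

lemma E_sets [measurable]: "E k \<in> sets lebesgue"
proof -
  have "E k = \<Omega> ((1 / 2) ^ k) \<inter> {z\<in>space lebesgue. w z < m k}" by (auto simp: E_def)
  also have "\<dots> \<in> sets lebesgue" by measurable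
  finally show ?thesis .
qed

lemma bounded_E: "bounded (E k)"
  using bounded_\<Omega> by (rule bounded_subset) (auto simp: E_def)

lemma initial_high:
  assumes "z \<in> \<Omega> ((1 / 2) ^ k)"
  shows "m0 * vol (side 0) \<le> \<mu> (past z (side 0))"
proof -
  have "(1 / 2 :: real) ^ k \<le> 1" by (intro power_le_one) auto
  then have "z \<in> \<Omega> 1" using \<Omega>_mono[of "(1/2)^k" 1] assms by auto
  then have "\<forall>i. \<bar>fst z $ i - x0 $ i\<bar> \<le> L" "t0 + \<gamma> / 2 * L powr p \<le> snd z" "snd z \<le> t0 + L powr p"
    by (auto simp: \<Omega>_def pbox_def cube_def mem_Times_iff)
  then show ?thesis using initial[of "fst z" "snd z"] by (simp add: past_def side_0)
qed

lemma past_lower_bound: "\<mu> (past z (side 0)) \<le> C1 ^ j * \<mu> (past z (side j))"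
proof (induction j)
  case (Suc j)
  have "\<mu> (past z (side j)) \<le> C1 * \<mu> (past z (side (Suc j)))"
    using past11[OF side_pos[of "Suc j"], of "fst z" "snd z"] unfolding past_def side_Suc[of j] by simp
  then have "C1 ^ j * \<mu> (past z (side j)) \<le> C1 ^ j * (C1 * \<mu> (past z (side (Suc j))))"
    using C1 by (intro mult_left_mono) auto
  then show ?case using Suc.IH by (simp add: mult_ac)
qed simp

text \<open>A halving lowers the mass by at most the factor \<open>C1\<close>, whereas each level is
  lower by the factor \<open>\<Lambda>\<close>, at least \<open>4 * C1\<close>; hence more than
  \<open>k\<close> halvings are needed. So the side at stopping is at most
  \<open>side (Suc k)\<close>.\<close>

lemma low_imp_small_side:
  assumes z: "z \<in> \<Omega> ((1 / 2) ^ k')" and low: "low k z j"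
  shows "k < j"
proof -
  have "m0 * vol (side 0) \<le> C1 ^ j * \<mu> (past z (side j))"
    using initial_high[OF z] past_lower_bound[of z j] by simp
  also have "\<dots> < C1 ^ j * (m k / K * vol (side j))"
    using low C1 by (intro mult_strict_left_mono) (auto simp: low_def)
  also have "\<dots> \<le> C1 ^ j * (m k / K * vol (side 0))"
    using C1 m_pos[of k] K side_pos[of j] side_antimono[of 0 j]
    by (intro mult_left_mono vol_mono) (auto intro: less_imp_le)
  finally have "m0 < C1 ^ j * (m k / K)"
    using vol_pos[OF side_pos[of 0]] by (simp only: mult.assoc[symmetric] mult_less_cancel_right_pos)
  then have "m0 * (\<Lambda> ^ k * K) < m0 * C1 ^ j"
    using \<Lambda>_ge(4) K(1) m0 by (simp add: m_def field_simps)
  then have *: "\<Lambda> ^ k * K < C1 ^ j" using m0 by (simp only: mult_less_cancel_left_pos)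
  have "C1 ^ k \<le> \<Lambda> ^ k" using C1 \<Lambda>_ge(1) by (intro power_mono) auto
  also have "\<dots> \<le> \<Lambda> ^ k * K" using \<Lambda>_ge K by simp
  finally have "C1 ^ k < C1 ^ j" using * by simp
  show ?thesis
  proof (rule ccontr)
    assume "\<not> k < j"
    then have "C1 ^ j \<le> C1 ^ k" using C1 by (intro power_increasing) auto
    then show False using \<open>C1 ^ k < C1 ^ j\<close> by simp
  qed
qed

text \<open>\<open>A\<close> lies directly before the past box of \<open>z\<close>. The parent past
  box is not low, so doubling with lag 12 keeps the mean over \<open>A\<close> at least
  \<open>1 / C1\<close> times the stopping level, while the future of \<open>A\<close> is the low
  past box itself. Thus \<open>comparable_proportion\<close> applies with
  \<open>\<delta> = 1 / C1\<close>.\<close>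

lemma stopped_box:
  assumes z: "z \<in> \<Omega> ((1 / 2) ^ Suc k)" and low: "low k z j" and first: "\<And>i. i < j \<Longrightarrow> \<not> low k z i"
  defines "A \<equiv> D (fst z) (snd z - 12 * side j powr p) (side j)"
  shows "A \<subseteq> \<Omega> ((1 / 2) ^ k)"
    and "1 / C1 / (2 * K) * vol (side j) \<le> measure lebesgue {z\<in>A. m (Suc k) \<le> w z \<and> w z < m k}"
proof -
  define l where "l = side j"
  have l: "l > 0" by (simp add: l_def side_pos)
  have kj: "k < j" by (rule low_imp_small_side[OF z low])
  define h where "h = (1 / 2 :: real) ^ Suc k"
  have h: "(1 / 2) ^ k = h + h" "h > 0" "h \<le> 1"
    using power_le_one[of "1 / 2 :: real" "Suc k"] by (simp_all add: h_def)
  have "l \<le> side (Suc k)" unfolding l_def using kj by (intro side_antimono) auto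
  also have "\<dots> = \<sigma> * h * L" by (simp add: side_def h_def field_simps power_one_over)
  finally have l_le: "l \<le> \<sigma> * h * L" .
  have \<sigma>h: "0 \<le> \<sigma> * h" "\<sigma> * h \<le> 1" using \<sigma> \<sigma>_le_1 h by (auto intro: mult_le_one)
  have "l powr p \<le> (\<sigma> * h * L) powr p" using l l_le p_gt_1 by (intro powr_mono2) auto
  also have "\<dots> = (\<sigma> * h) powr p * L powr p" using \<sigma>h L by (simp add: powr_mult)
  also have "\<dots> \<le> (\<sigma> * h) * L powr p" using \<sigma>h by (intro mult_right_mono powr_p_le) auto
  finally have lp: "l powr p \<le> (\<sigma> * h) * L powr p" .
  \<comment> \<open>Passing from \<open>\<Omega> h\<close> to \<open>\<Omega> (h + h)\<close> gains
    \<open>\<gamma> * h * L powr p / 2\<close> in time, and \<open>A\<close> reaches back by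
    \<open>12 * l powr p\<close>; hence the constant 24.\<close>
  have lp24: "24 * l powr p \<le> \<gamma> * h * L powr p"
  proof -
    have "24 * l powr p \<le> 24 * \<sigma> * (h * L powr p)" using lp by (simp add: mult_ac)
    also have "\<dots> \<le> \<gamma> * (h * L powr p)" using \<sigma> h by (intro mult_right_mono) auto
    finally show ?thesis by (simp add: mult_ac)
  qed
  have lh: "l \<le> h * L"
  proof -
    have "\<sigma> * (h * L) \<le> 1 * (h * L)" using \<sigma>_le_1 h L by (intro mult_right_mono) auto
    then show ?thesis using l_le by (simp add: mult_ac)
  qed
  show "A \<subseteq> \<Omega> ((1 / 2) ^ k)"
    unfolding A_def D_def \<Omega>_def l_def[symmetric] h(1)
  proof (rule pbox_mono)
    have zc: "\<bar>fst z $ i - x0 $ i\<bar> \<le> (1 + h) * L / 2" for i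
      using z by (auto simp: \<Omega>_def pbox_def cube_def mem_Times_iff h_def)
    have zt: "t0 + \<gamma> * (1 - h / 2) * L powr p < snd z" "snd z < t0 + L powr p"
      using z by (auto simp: \<Omega>_def pbox_def cube_def mem_Times_iff h_def)
    show "\<bar>x0 $ i - fst z $ i\<bar> \<le> ((1 + (h + h)) * L - l) / 2" for i
    proof -
      have "(1 + h) * L / 2 \<le> ((1 + (h + h)) * L - l) / 2"
        using lh by (intro divide_right_mono) (simp_all add: algebra_simps)
      then show ?thesis using zc[of i] by linarith
    qed
    have "\<gamma> * (1 - (h + h) / 2) * L powr p = \<gamma> * (1 - h / 2) * L powr p - \<gamma> * h * L powr p / 2"
      by (simp add: field_simps)
    then show "t0 + \<gamma> * (1 - (h + h) / 2) * L powr p \<le> snd z - 12 * l powr p"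
      using zt(1) lp24 by linarith
    show "snd z - 12 * l powr p + l powr p \<le> t0 + L powr p"
      using zt(2) powr_ge_zero[of l p] by linarith
  qed
  \<comment> \<open>Since \<open>k < j\<close>, stopping does not occur at the first box, and there
    is a parent of twice the side.\<close>
  obtain i where j: "j = Suc i" using kj by (cases j) auto
  define \<tau> where "\<tau> = m k / K"
  have \<tau>: "\<tau> > 0" using m_pos K by (simp add: \<tau>_def)
  have \<eta>: "1 / C1 / 4 * \<tau> = m (Suc k)" "K * \<tau> = m k" using K by (auto simp: \<tau>_def m_Suc)
  have "1 / C1 * \<tau> * vol l \<le> \<mu> (D (fst z) (snd z - 12 * l powr p) l)"
  proof -
    have "\<tau> * vol l \<le> \<tau> * vol (side i)"
      using \<tau> l side_antimono[of i j] unfolding l_def j by (intro mult_left_mono vol_mono) auto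
    also have "\<dots> \<le> \<mu> (past z (side i))"
      using first[of i] by (simp add: j low_def \<tau>_def)
    also have "\<dots> \<le> C1 * \<mu> (D (fst z) (snd z - 12 * l powr p) l)"
      using past12[OF l, of "fst z" "snd z"] unfolding past_def side_Suc[of i] l_def j .
    finally show ?thesis using C1 by (simp add: field_simps)
  qed
  moreover have "\<mu> (D (fst z) (snd z - 12 * l powr p + l powr p) l) \<le> \<tau> * vol l"
  proof -
    have "snd z - 12 * l powr p + l powr p = snd z - 11 * l powr p" by simp
    then show ?thesis using low by (simp add: low_def past_def \<tau>_def l_def)
  qed
  ultimately show "1 / C1 / (2 * K) * vol (side j) \<le> measure lebesgue {z\<in>A. m (Suc k) \<le> w z \<and> w z < m k}"
    using comparable_proportion[OF l \<tau> _ K, of "fst z" "snd z - 12 * l powr p"] C1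
    unfolding \<eta> A_def l_def by simp
qed

text \<open>High enough to contain the past box and the stopped box, and symmetric in time so that
  \<open>z\<close> is an interior point.\<close>

definition nbhd :: "(real^'n) \<times> real \<Rightarrow> real \<Rightarrow> ((real^'n) \<times> real) set" where
  "nbhd z l = pbox (fst z) l (snd z - 12 * l powr p) (snd z + 12 * l powr p)"

definition nbhd3 :: "(real^'n) \<times> real \<Rightarrow> real \<Rightarrow> ((real^'n) \<times> real) set" where
  "nbhd3 z l = pbox (fst z) (3 * l) (snd z - 36 * l powr p) (snd z + 36 * l powr p)"

definition "overlap = (72 * 3 ^ CARD('n) :: real)"

lemma measure_nbhd3:
  assumes "l > 0"
  shows "measure lebesgue (nbhd3 z l) = overlap * vol l"
  unfolding nbhd3_def using assms
  by (subst measure_pbox) (simp_all add: overlap_def vol_def power_mult_distrib)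

text \<open>Vitali engulfing. In time, the distance of the centres plus the half height of the
  smaller set is at most 12 + 12 + 12 units \<open>l' powr p\<close>.\<close>

lemma nbhd_subset_nbhd3:
  assumes l: "0 < l" "l \<le> l'" and meet: "nbhd z l \<inter> nbhd z' l' \<noteq> {} \<or> z = z'"
  shows "nbhd z l \<subseteq> nbhd3 z' l'"
proof -
  have lp: "l powr p \<le> l' powr p" using l p_gt_1 by (intro powr_mono2) auto
  have "\<bar>fst z' $ i - fst z $ i\<bar> \<le> l / 2 + l' / 2" for i
  proof (cases "z = z'")
    case False
    then obtain y where y: "y \<in> nbhd z l" "y \<in> nbhd z' l'" using meet by auto
    have "\<bar>fst y $ i - fst z $ i\<bar> \<le> l / 2" "\<bar>fst y $ i - fst z' $ i\<bar> \<le> l' / 2"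
      using y by (auto simp: nbhd_def pbox_def cube_def mem_Times_iff)
    then show ?thesis by linarith
  qed (use l in auto)
  moreover have "l / 2 + l' / 2 \<le> (3 * l' - l) / 2" using l by (simp add: field_simps)
  ultimately have x: "\<bar>fst z' $ i - fst z $ i\<bar> \<le> (3 * l' - l) / 2" for i
    by (meson order_trans)
  have t: "\<bar>snd z' - snd z\<bar> \<le> 12 * l powr p + 12 * l' powr p"
  proof (cases "z = z'")
    case False
    then obtain y where y: "y \<in> nbhd z l" "y \<in> nbhd z' l'" using meet by auto
    then show ?thesis by (auto simp: nbhd_def pbox_def mem_Times_iff)
  qed auto
  show ?thesis unfolding nbhd_def nbhd3_def
    using t lp by (intro pbox_mono x) auto
qed

lemma measure_past:
  assumes "l > 0"
  shows "measure lebesgue (past z l) = vol l"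
  unfolding past_def D_def using assms by (subst measure_pbox) (simp_all add: vol_def)

lemma past_subset_nbhd: "past z l \<subseteq> nbhd z l"
  unfolding past_def D_def nbhd_def using powr_ge_zero[of l p] by (intro pbox_mono) auto

lemma stopped_subset_nbhd: "D (fst z) (snd z - 12 * l powr p) l \<subseteq> nbhd z l"
  unfolding D_def nbhd_def using powr_ge_zero[of l p] by (intro pbox_mono) auto

lemma past_near:
  assumes "d > 0"
  shows "\<exists>j. \<forall>z. \<forall>y\<in>past z (side j). dist z y < d"
proof -
  \<comment> \<open>Half a side for each space coordinate and 11 for time bound the distance by
    \<open>N * l\<close>, once \<open>l < 1\<close> gives \<open>l powr p \<le> l\<close>.\<close>
  define N where "N = real CARD('n) / 2 + 11"
  have N: "N > 0" by (simp add: N_def)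
  have \<sigma>L: "\<sigma> * L > 0" using \<sigma> L by simp
  have "0 < min 1 (d / N) / (\<sigma> * L)" using \<sigma>L N assms by simp
  then obtain j where "(1 / 2) ^ j < min 1 (d / N) / (\<sigma> * L)"
    using real_arch_pow_inv[of "min 1 (d / N) / (\<sigma> * L)" "1 / 2"] by auto
  then have "(1 / 2) ^ j * (\<sigma> * L) < min 1 (d / N)" using \<sigma>L by (simp only: pos_less_divide_eq)
  then have "side j < min 1 (d / N)" by (simp add: side_def power_one_over)
  moreover define l where "l = side j"
  ultimately have l: "l < 1" "N * l < d" using N by (auto simp: field_simps)
  have l0: "l > 0" by (simp add: l_def side_pos)
  have "l powr p \<le> l" using l l0 by (intro powr_p_le) auto
  have "dist z y < d" if y: "y \<in> past z (side j)" for z y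
  proof -
    have y': "\<bar>fst y $ i - fst z $ i\<bar> \<le> l / 2" "\<bar>snd y - snd z\<bar> \<le> 11 * l powr p" for i
      using y powr_ge_zero[of l p] unfolding l_def[symmetric]
      by (auto simp: past_def D_def pbox_def cube_def mem_Times_iff)
    have "norm (fst y - fst z) \<le> (\<Sum>i\<in>UNIV. \<bar>(fst y - fst z) $ i\<bar>)" by (rule norm_le_l1_cart)
    also have "\<dots> \<le> (\<Sum>i\<in>(UNIV::'n set). l / 2)" using y'(1) by (intro sum_mono) auto
    also have "\<dots> = real CARD('n) / 2 * l" by simp
    finally have x: "dist (fst z) (fst y) \<le> real CARD('n) / 2 * l" by (simp add: dist_norm norm_minus_commute)
    have t: "dist (snd z) (snd y) \<le> 11 * l"
      using y'(2) \<open>l powr p \<le> l\<close> by (simp add: dist_real_def)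
    have "dist z y \<le> dist (fst z) (fst y) + dist (snd z) (snd y)"
      unfolding dist_prod_def by (rule sqrt_sum_squares_le_sum) auto
    also have "\<dots> \<le> N * l" using x t by (simp add: N_def algebra_simps)
    finally show ?thesis using l(2) by simp
  qed
  then show ?thesis by blast
qed

section \<open>The covering argument\<close>

lemma E_Suc_subset: "E (Suc k) \<subseteq> E k"
proof -
  have "m (Suc k) \<le> m k"
    using m0 \<Lambda>_ge by (auto simp: m_def intro!: divide_left_mono)
  moreover have "\<Omega> ((1 / 2) ^ Suc k) \<subseteq> \<Omega> ((1 / 2) ^ k)" by (intro \<Omega>_mono) auto
  ultimately show ?thesis by (fastforce simp: E_def)
qed

lemma lmeasurable_E: "E k \<in> lmeasurable"
  by (intro bounded_set_imp_lmeasurable bounded_E E_sets)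

text \<open>Tripling costs \<open>overlap\<close>, and \<open>2 * C1 * K\<close> is the inverse of
  the proportion found in \<open>stopped_box\<close>.\<close>

definition "M = overlap * (2 * C1 * K)"

lemma M_pos: "M > 0" using C1 K by (simp add: M_def overlap_def)

text \<open>A Vitali selection at points of \<open>S\<close> consists of points that stop
  (\<open>P\<close>) and points that never do (\<open>N\<close>). The former own disjoint portions
  of \<open>E k - E (Suc k)\<close>. The latter own tiny past boxes close to \<open>S\<close> of
  mean at least \<open>\<tau>\<close>, although \<open>w\<close> is below \<open>\<tau> / 2\<close>
  on \<open>S\<close>, so their total volume is at most \<open>e\<close>; this takes the place of a
  differentiation theorem.\<close>

lemma compact_level_set_bound:
  assumes S: "compact S" "S \<subseteq> E (Suc k)" and e: "e > 0"
  shows "measure lebesgue S \<le> M * (measure lebesgue (E k) - measure lebesgue (E (Suc k))) + overlap * e"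
proof -
  define \<tau> where "\<tau> = m k / K"
  have \<tau>: "\<tau> > 0" using m_pos K by (simp add: \<tau>_def)
  have lmS: "S \<in> lmeasurable" using S(1) by (rule lmeasurable_compact)
  \<comment> \<open>The mass outside \<open>S\<close> gets this tolerance; absorbing the mass inside
    \<open>S\<close> and dividing by \<open>\<tau> / 2\<close> leaves exactly
    \<open>e\<close>.\<close>
  have "e * \<tau> / 2 > 0" using e \<tau> by simp
  then obtain d where d: "d > 0" "\<And>B. B \<in> sets lebesgue \<Longrightarrow> bounded B \<Longrightarrow>
      (\<And>z. z \<in> B \<Longrightarrow> \<exists>k\<in>S. dist k z < d) \<Longrightarrow> \<mu> (B - S) < e * \<tau> / 2"
    using wmeas_outer[OF weight S(1)] by metis
  obtain jn where jn: "\<And>z y. y \<in> past z (side jn) \<Longrightarrow> dist z y < d"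
    using past_near[OF d(1)] by blast
  define stops where "stops z \<longleftrightarrow> (\<exists>i. low k z i)" for z
  \<comment> \<open>Points that never stop get the default index \<open>jn\<close>, whose past box
    stays within \<open>d\<close> of the point.\<close>
  define j where "j z = (if stops z then LEAST i. low k z i else jn)" for z
  define l where "l z = side (j z)" for z
  have l: "l z > 0" for z by (simp add: l_def side_pos)
  \<comment> \<open>The cubes in \<open>nbhd\<close> are closed; compactness is applied to their
    interiors.\<close>
  define U where "U z = box (\<chi> i. fst z $ i - l z / 2) (\<chi> i. fst z $ i + l z / 2) \<times>
    {snd z - 12 * l z powr p <..< snd z + 12 * l z powr p}" for z
  have U_sub: "U z \<subseteq> nbhd z (l z)" for z
    unfolding U_def nbhd_def pbox_def cube_eq_cbox using box_subset_cbox by blast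
  have "open (U z)" for z unfolding U_def by (intro open_Times open_box open_greaterThanLessThan)
  moreover have "S \<subseteq> (\<Union>z\<in>S. U z)"
  proof
    fix z assume "z \<in> S"
    moreover have "z \<in> U z" using l[of z] by (auto simp: U_def mem_box_cart mem_Times_iff)
    ultimately show "z \<in> (\<Union>z\<in>S. U z)" by blast
  qed
  ultimately obtain F where F: "F \<subseteq> S" "finite F" "S \<subseteq> (\<Union>z\<in>F. U z)"
    using compactE_image[OF S(1), of S U] by metis
  obtain C where C: "C \<subseteq> F" "\<And>y z. y \<in> C \<Longrightarrow> z \<in> C \<Longrightarrow> y \<noteq> z \<Longrightarrow> nbhd y (l y) \<inter> nbhd z (l z) = {}"
    "\<And>y. y \<in> F \<Longrightarrow> \<exists>z\<in>C. l y \<le> l z \<and> (nbhd y (l y) \<inter> nbhd z (l z) \<noteq> {} \<or> y = z)"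
    using greedy_disjoint_subfamily[OF F(2), of "\<lambda>z. nbhd z (l z)" l] by metis
  have fC: "finite C" using C(1) F(2) by (rule finite_subset)
  define P where "P = {z\<in>C. stops z}"
  define N where "N = {z\<in>C. \<not> stops z}"
  have fPN: "finite P" "finite N" "P \<inter> N = {}" "C = P \<union> N" "P \<subseteq> C" "N \<subseteq> C"
    using fC by (auto simp: P_def N_def)

  have "S \<subseteq> (\<Union>z\<in>C. nbhd3 z (l z))"
  proof
    fix s assume "s \<in> S"
    then obtain y where y: "y \<in> F" "s \<in> nbhd y (l y)" using F(3) U_sub by blast
    obtain z where z: "z \<in> C" "l y \<le> l z" "nbhd y (l y) \<inter> nbhd z (l z) \<noteq> {} \<or> y = z"
      using C(3)[OF y(1)] by blast
    then show "s \<in> (\<Union>z\<in>C. nbhd3 z (l z))" using nbhd_subset_nbhd3[OF l z(2,3)] y(2) by blast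
  qed
  then have "measure lebesgue S \<le> measure lebesgue (\<Union>z\<in>C. nbhd3 z (l z))"
    using lmS fC by (intro measure_mono_fmeasurable fmeasurable.finite_UN)
      (auto simp: nbhd3_def lmeasurable_pbox)
  also have "\<dots> \<le> (\<Sum>z\<in>C. measure lebesgue (nbhd3 z (l z)))"
    using fC by (intro measure_UNION_le) (auto simp: nbhd3_def)
  also have "\<dots> = overlap * (\<Sum>z\<in>C. vol (l z))"
    using l by (simp add: measure_nbhd3 sum_distrib_left)
  also have "(\<Sum>z\<in>C. vol (l z)) = (\<Sum>z\<in>P. vol (l z)) + (\<Sum>z\<in>N. vol (l z))"
    unfolding fPN(4) using fPN by (intro sum.union_disjoint) auto
  finally have S_le: "measure lebesgue S \<le> overlap * ((\<Sum>z\<in>P. vol (l z)) + (\<Sum>z\<in>N. vol (l z)))" .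

  have "1 / C1 / (2 * K) * (\<Sum>z\<in>P. vol (l z)) \<le> measure lebesgue (E k) - measure lebesgue (E (Suc k))"
  proof -
    define A where "A z = D (fst z) (snd z - 12 * l z powr p) (l z)" for z
    define T where "T z = {y\<in>A z. m (Suc k) \<le> w y \<and> w y < m k}" for z
    have T: "1 / C1 / (2 * K) * vol (l z) \<le> measure lebesgue (T z)" "T z \<subseteq> E k - E (Suc k)"
      if z: "z \<in> P" for z
    proof -
      have zs: "stops z" "z \<in> E (Suc k)" using z C(1) F(1) S(2) by (auto simp: P_def)
      have jz: "j z = (LEAST i. low k z i)" using zs by (simp add: j_def)
      have lowz: "low k z (j z)" using zs(1) unfolding jz stops_def by (rule LeastI_ex)
      have first: "\<not> low k z i" if "i < j z" for i using that unfolding jz by (rule not_less_Least)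
      have z\<Omega>: "z \<in> \<Omega> ((1 / 2) ^ Suc k)" using zs(2) by (simp add: E_def)
      show "1 / C1 / (2 * K) * vol (l z) \<le> measure lebesgue (T z)"
        using stopped_box(2)[OF z\<Omega> lowz first] by (simp add: T_def A_def l_def)
      show "T z \<subseteq> E k - E (Suc k)"
        using stopped_box(1)[OF z\<Omega> lowz first] by (auto simp: T_def A_def l_def E_def)
    qed
    have T_sets: "T z \<in> sets lebesgue" for z
    proof -
      have "T z = A z \<inter> {y\<in>space lebesgue. m (Suc k) \<le> w y \<and> w y < m k}" by (auto simp: T_def)
      also have "\<dots> \<in> sets lebesgue" unfolding A_def by measurable
      finally show ?thesis .
    qed
    have lmT: "T z \<in> lmeasurable" for z
    proof (rule bounded_set_imp_lmeasurable[OF _ T_sets])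
      have "bounded (A z)" by (simp add: A_def D_def bounded_pbox)
      then show "bounded (T z)" by (rule bounded_subset) (auto simp: T_def)
    qed
    have disj: "pairwise (\<lambda>y z. disjnt (T y) (T z)) P"
    proof (rule pairwiseI)
      fix y z assume yz: "y \<in> P" "z \<in> P" "y \<noteq> z"
      have "T y \<subseteq> nbhd y (l y)" "T z \<subseteq> nbhd z (l z)"
        using stopped_subset_nbhd unfolding T_def A_def by blast+
      then show "disjnt (T y) (T z)" using C(2)[of y z] yz fPN(5) by (auto simp: disjnt_def)
    qed
    have "1 / C1 / (2 * K) * (\<Sum>z\<in>P. vol (l z)) \<le> (\<Sum>z\<in>P. measure lebesgue (T z))"
      unfolding sum_distrib_left by (intro sum_mono T)
    also have "\<dots> = measure lebesgue (\<Union>z\<in>P. T z)"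
      using fPN(1) lmT disj by (intro measure_UNION'[symmetric]) auto
    also have "\<dots> \<le> measure lebesgue (E k - E (Suc k))"
      using T(2) T_sets fPN(1) by (intro measure_mono_fmeasurable fmeasurable.Diff lmeasurable_E) auto
    also have "\<dots> = measure lebesgue (E k) - measure lebesgue (E (Suc k))"
      using E_Suc_subset lmeasurable_E by (intro measurable_measure_Diff) (auto dest: fmeasurableD)
    finally show ?thesis .
  qed
  moreover have "overlap * (\<Sum>z\<in>P. vol (l z)) = M * (1 / C1 / (2 * K) * (\<Sum>z\<in>P. vol (l z)))"
    using C1 K by (simp add: M_def)
  ultimately have P_le: "overlap * (\<Sum>z\<in>P. vol (l z)) \<le> M * (measure lebesgue (E k) - measure lebesgue (E (Suc k)))"
    using M_pos by (simp only: mult_le_cancel_left_pos)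

  have "(\<Sum>z\<in>N. vol (l z)) \<le> e"
  proof -
    define B where "B = (\<Union>z\<in>N. past z (l z))"
    have B: "B \<in> sets lebesgue" "bounded B"
      unfolding B_def using fPN(2) by (auto simp: past_def D_def bounded_pbox)
    have lmB: "B \<in> lmeasurable" using B by (intro bounded_set_imp_lmeasurable)
    have vol_B: "measure lebesgue B \<le> (\<Sum>z\<in>N. vol (l z))"
    proof -
      have "measure lebesgue B \<le> (\<Sum>z\<in>N. measure lebesgue (past z (l z)))"
        unfolding B_def using fPN(2) by (intro measure_UNION_le) (auto simp: past_def)
      also have "\<dots> = (\<Sum>z\<in>N. vol (l z))"
        using l by (simp only: measure_past)
      finally show ?thesis .
    qed
    have high: "\<tau> * vol (l z) \<le> \<mu> (past z (l z))" if "z \<in> N" for z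
      using that by (simp add: N_def stops_def low_def l_def \<tau>_def not_less)
    have near: "\<exists>s\<in>S. dist s y < d" if yB: "y \<in> B" for y
    proof -
      obtain z where z: "z \<in> N" "y \<in> past z (l z)" using yB unfolding B_def by blast
      then have "z \<in> S" "y \<in> past z (side jn)" using C(1) F(1) by (auto simp: N_def l_def j_def)
      then show ?thesis using jn by blast
    qed
    have disj: "pairwise (\<lambda>y z. disjnt (past y (l y)) (past z (l z))) N"
    proof (rule pairwiseI)
      fix y z assume yz: "y \<in> N" "z \<in> N" "y \<noteq> z"
      then show "disjnt (past y (l y)) (past z (l z))"
        using C(2)[of y z] fPN(6) past_subset_nbhd[of y "l y"] past_subset_nbhd[of z "l z"]
        unfolding disjnt_def by blast
    qed
    have "\<tau> * (\<Sum>z\<in>N. vol (l z)) \<le> (\<Sum>z\<in>N. \<mu> (past z (l z)))"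
      unfolding sum_distrib_left by (intro sum_mono high)
    also have "\<dots> = \<mu> B"
      unfolding B_def using fPN(2) disj
      by (intro measure_UNION'[symmetric]) (auto simp: past_def D_def intro!: wmeas_fmeasurable weight bounded_pbox)
    also have "\<dots> \<le> \<mu> (B - S) + \<mu> (B \<inter> S)"
    proof -
      have "\<mu> ((B - S) \<union> (B \<inter> S)) \<le> \<mu> (B - S) + \<mu> (B \<inter> S)"
        using B lmS by (intro measure_Un_le) (auto dest: fmeasurableD)
      then show ?thesis by (simp add: Un_Diff_Int)
    qed
    also have "\<mu> (B - S) \<le> e * \<tau> / 2" using d(2)[OF B near] by simp
    also have "\<mu> (B \<inter> S) \<le> m (Suc k) * measure lebesgue (B \<inter> S)"
    proof (rule \<mu>_le_measure)
      show "B \<inter> S \<in> sets lebesgue" using B(1) lmS by (auto dest: fmeasurableD)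
      show "bounded (B \<inter> S)" using B(2) by blast
      show "w z \<le> m (Suc k)" if "z \<in> B \<inter> S" for z using that S(2) by (auto simp: E_def)
    qed (use m_pos[of "Suc k"] in simp)
    \<comment> \<open>\<open>m (Suc k)\<close> is \<open>\<tau> / (4 * C1)\<close>, so this term is
      at most half of the left-hand side and is absorbed.\<close>
    also have "\<dots> \<le> \<tau> / 2 * (\<Sum>z\<in>N. vol (l z))"
    proof -
      have "1 / C1 / 4 \<le> 1 / 2" using C1 by (simp add: field_simps)
      then have "1 / C1 / 4 * \<tau> \<le> 1 / 2 * \<tau>" using \<tau> by (intro mult_right_mono) auto
      then have "m (Suc k) \<le> \<tau> / 2" by (simp only: m_Suc \<tau>_def) simp
      moreover have "measure lebesgue (B \<inter> S) \<le> measure lebesgue B"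
        using B lmB lmS by (intro measure_mono_fmeasurable) (auto dest: fmeasurableD)
      ultimately show ?thesis using vol_B \<tau> by (intro mult_mono) auto
    qed
    finally have "\<tau> / 2 * (\<Sum>z\<in>N. vol (l z)) \<le> \<tau> / 2 * e" by (simp add: algebra_simps)
    then show ?thesis using \<tau> by (simp only: mult_le_cancel_left_pos half_gt_zero)
  qed
  then have "overlap * (\<Sum>z\<in>N. vol (l z)) \<le> overlap * e" by (intro mult_left_mono) (auto simp: overlap_def)
  then show ?thesis using S_le P_le by (simp add: distrib_left)
qed

text \<open>Inner regularity passes from compact subsets to \<open>E (Suc k)\<close>. Moving its
  measure from the right-hand side to the left then gives a ratio below 1 (hole filling).\<close>

lemma level_set_decay_step:
  "measure lebesgue (E (Suc k)) \<le> M / (1 + M) * measure lebesgue (E k)"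
proof -
  have "measure lebesgue (E (Suc k)) \<le> M * (measure lebesgue (E k) - measure lebesgue (E (Suc k))) + e"
    if e: "e > 0" for e
  proof -
    have o: "overlap > 0" by (simp add: overlap_def)
    \<comment> \<open>Half of \<open>e\<close> is spent on the compact approximation and half on the
      covering error \<open>overlap * e'\<close>.\<close>
    define e' where "e' = e / (2 * overlap)"
    have e': "e' > 0" using e o by (simp add: e'_def)
    obtain S where S: "closed S" "S \<subseteq> E (Suc k)" "E (Suc k) - S \<in> lmeasurable"
      "emeasure lebesgue (E (Suc k) - S) < ennreal (e / 2)"
      using sets_lebesgue_inner_closed[OF E_sets, of "e / 2" "Suc k"] e by (metis half_gt_zero)
    have cS: "compact S" using S bounded_subset[OF bounded_E S(2)] by (simp add: compact_eq_bounded_closed)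
    have "measure lebesgue (E (Suc k) - S) < e / 2"
      using S(4) e unfolding emeasure_eq_measure2[OF S(3)] by (simp add: ennreal_less_iff)
    moreover have "measure lebesgue (E (Suc k) - S) = measure lebesgue (E (Suc k)) - measure lebesgue S"
      using S(2) cS lmeasurable_E by (intro measurable_measure_Diff) (auto dest: lmeasurable_compact fmeasurableD)
    moreover have "overlap * e' = e / 2" using o by (simp add: e'_def)
    ultimately show ?thesis using compact_level_set_bound[OF cS S(2) e'] by linarith
  qed
  then have "measure lebesgue (E (Suc k)) \<le> M * (measure lebesgue (E k) - measure lebesgue (E (Suc k)))"
    by (rule field_le_epsilon)
  then have "(1 + M) * measure lebesgue (E (Suc k)) \<le> M * measure lebesgue (E k)"
    by (simp add: algebra_simps)
  then show ?thesis using M_pos by (simp add: field_simps)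
qed

lemma level_set_decay:
  "measure lebesgue (E k) \<le> (M / (1 + M)) ^ k * measure lebesgue (\<Omega> 1)"
proof (induction k)
  case 0
  have "E 0 \<subseteq> \<Omega> 1" by (auto simp: E_def)
  then show ?case
    by (simp, intro measure_mono_fmeasurable) (auto simp: \<Omega>_def lmeasurable_pbox)
next
  case (Suc k)
  have "measure lebesgue (E (Suc k)) \<le> M / (1 + M) * measure lebesgue (E k)" by (rule level_set_decay_step)
  also have "\<dots> \<le> M / (1 + M) * ((M / (1 + M)) ^ k * measure lebesgue (\<Omega> 1))"
    using Suc.IH M_pos by (intro mult_left_mono) auto
  finally show ?case by (simp add: mult.assoc)
qed

end

subsection \<open>Integrability of a negative power\<close>

lemma ennpowr_neg:
  assumes "0 \<le> u" "\<beta> > 0"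
  shows "ennpowr (ennreal u) (- \<beta>) = (if u = 0 then \<infinity> else ennreal (u powr (- \<beta>)))"
  using assms by (auto simp: ennpowr_def)

lemma ennpowr_pos:
  assumes "0 \<le> u" "a > 0"
  shows "ennpowr (ennreal u) a = ennreal (u powr a)"
  using assms by (auto simp: ennpowr_def)

lemma ennpowr_mono:
  assumes "u \<le> v" "a > 0"
  shows "ennpowr u a \<le> ennpowr v a"
proof (cases "v = \<infinity>")
  case False
  then have "u \<noteq> \<infinity>" using assms(1) by (auto simp: top_unique)
  with False show ?thesis using assms
    by (cases u; cases v) (auto simp: ennpowr_pos intro!: ennreal_leI powr_mono2)
qed (use assms in \<open>auto simp: ennpowr_def\<close>)

context level_set_decay
begin

lemma m_Suc_powr: "m (Suc k) powr (- \<beta>) = m0 powr (- \<beta>) * (\<Lambda> powr \<beta>) ^ Suc k"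
proof -
  have "m (Suc k) powr (- \<beta>) = (m0 * \<Lambda> powr (- real (Suc k))) powr (- \<beta>)"
    using \<Lambda>_ge by (simp only: m_def powr_minus powr_realpow divide_inverse)
  also have "\<dots> = m0 powr (- \<beta>) * \<Lambda> powr (real (Suc k) * \<beta>)"
    using m0 by (simp add: powr_mult powr_powr del: of_nat_Suc)
  also have "\<Lambda> powr (real (Suc k) * \<beta>) = (\<Lambda> powr \<beta>) ^ Suc k"
    using \<Lambda>_ge by (simp only: mult.commute[of "real (Suc k)"] powr_powr[symmetric] powr_realpow powr_gt_zero)
  finally show ?thesis .
qed

text \<open>On \<open>\<Omega> 0\<close>, membership in \<open>E k\<close> depends only on the value
  of \<open>w\<close>. A value from \<open>m (Suc i)\<close> up to \<open>m i\<close> puts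
  \<open>z\<close> in \<open>E i\<close>, and that single term bounds the negative power.\<close>

lemma negative_power_le_layers:
  assumes \<beta>: "\<beta> > 0" and z: "z \<in> \<Omega> 0"
  shows "ennpowr (ennreal (w z)) (- \<beta>) \<le> ennreal (m0 powr (- \<beta>)) +
    (\<Sum>k. ennreal (m (Suc k) powr (- \<beta>)) * indicator (E k) z)"
proof -
  have z\<Omega>: "z \<in> \<Omega> ((1 / 2) ^ k)" for k using z \<Omega>_mono[of 0 "(1/2)^k"] by auto
  consider "w z = 0" | "m0 \<le> w z" | "0 < w z" "w z < m0" using w_nonneg[of z] by linarith
  then show ?thesis
  proof cases
    \<comment> \<open>The negative power is infinite here, but \<open>z\<close> lies in every
      \<open>E k\<close> and the terms do not tend to 0, so the series is infinite too.\<close>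
    case 1
    then have "z \<in> E k" for k using z\<Omega> m_pos by (simp add: E_def)
    moreover have "\<not> summable (\<lambda>k. m (Suc k) powr (- \<beta>))"
    proof -
      have "1 \<le> \<Lambda> powr \<beta>" using \<Lambda>_ge(3) \<beta> by (intro ge_one_powr_ge_zero) auto
      then show ?thesis using m0 \<Lambda>_ge(4) by (simp add: m_Suc_powr)
    qed
    ultimately show ?thesis
      by (simp add: summable_iff_suminf_neq_top)
  next
    case 2
    then have "w z powr (- \<beta>) \<le> m0 powr (- \<beta>)" using m0 \<beta> by (intro powr_mono2') auto
    then show ?thesis using 2 m0 \<beta> by (auto simp: ennpowr_neg intro!: add_increasing2 ennreal_leI)
  next
    case 3
    have "\<exists>k. m k \<le> w z"
    proof -
      obtain k where "m0 / w z < \<Lambda> ^ k" using real_arch_pow[of \<Lambda> "m0 / w z"] \<Lambda>_ge(3) by auto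
      then have "m k \<le> w z" using 3 \<Lambda>_ge(4) by (simp add: m_def field_simps)
      then show ?thesis by blast
    qed
    then have L: "m (LEAST k. m k \<le> w z) \<le> w z" by (rule LeastI_ex)
    \<comment> \<open>The least index is not 0 because \<open>w z < m0\<close> and
      \<open>m 0 = m0\<close>; its predecessor is the layer of \<open>z\<close>.\<close>
    then obtain i where i: "(LEAST k. m k \<le> w z) = Suc i"
      using 3 by (cases "LEAST k. m k \<le> w z") (auto simp: m_def)
    have "\<not> m i \<le> w z" using not_less_Least[of i "\<lambda>k. m k \<le> w z"] i by simp
    then have zE: "z \<in> E i" using z\<Omega> by (simp add: E_def)
    have "w z powr (- \<beta>) \<le> m (Suc i) powr (- \<beta>)" using L m_pos \<beta> unfolding i by (intro powr_mono2') auto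
    then have "ennpowr (ennreal (w z)) (- \<beta>) \<le> ennreal (m (Suc i) powr (- \<beta>)) * indicator (E i) z"
      using 3 \<beta> zE by (simp add: ennpowr_neg ennreal_leI)
    also have "\<dots> \<le> (\<Sum>k. ennreal (m (Suc k) powr (- \<beta>)) * indicator (E k) z)"
    proof -
      define f where "f = (\<lambda>k. ennreal (m (Suc k) powr (- \<beta>)) * (indicator (E k) z :: ennreal))"
      have "sum f {i} \<le> suminf f" by (rule sum_le_suminf) auto
      then have "f i \<le> suminf f" by simp
      then show ?thesis unfolding f_def .
    qed
    finally show ?thesis by (simp add: add_increasing)
  qed
qed

text \<open>Integrating the layers and inserting the decay of \<open>E k\<close> gives a geometric
  series of ratio \<open>\<Lambda> powr \<beta> * (M / (1 + M))\<close>.\<close>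

lemma negative_power_integral:
  assumes \<beta>: "\<beta> > 0" "\<Lambda> powr \<beta> * (M / (1 + M)) < 1"
  shows "(\<integral>\<^sup>+z\<in>\<Omega> 0. ennpowr (ennreal (w z)) (- \<beta>) \<partial>lebesgue) \<le>
    ennreal (m0 powr (- \<beta>) * (measure lebesgue (\<Omega> 0) +
      \<Lambda> powr \<beta> / (1 - \<Lambda> powr \<beta> * (M / (1 + M))) * measure lebesgue (\<Omega> 1)))"
proof -
  define r where "r = \<Lambda> powr \<beta>"
  define \<theta> where "\<theta> = M / (1 + M)"
  define V where "V s = measure lebesgue (\<Omega> s)" for s
  have r: "r > 0" using \<Lambda>_ge by (simp add: r_def)
  have \<theta>: "0 < \<theta>" "r * \<theta> < 1" using M_pos \<beta> by (simp_all add: \<theta>_def r_def)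
  have em: "emeasure lebesgue (\<Omega> 0) = ennreal (V 0)"
    unfolding V_def by (intro emeasure_eq_measure2) (simp add: \<Omega>_def lmeasurable_pbox)
  have "(\<integral>\<^sup>+z\<in>\<Omega> 0. ennpowr (ennreal (w z)) (- \<beta>) \<partial>lebesgue) \<le>
    (\<integral>\<^sup>+z. ennreal (m0 powr (- \<beta>)) * indicator (\<Omega> 0) z +
      (\<Sum>k. ennreal (m (Suc k) powr (- \<beta>)) * indicator (E k) z) \<partial>lebesgue)"
    using negative_power_le_layers[OF \<beta>(1)]
    by (intro nn_integral_mono) (auto simp: indicator_def)
  also have "\<dots> = ennreal (m0 powr (- \<beta>)) * emeasure lebesgue (\<Omega> 0) +
      (\<Sum>k. ennreal (m (Suc k) powr (- \<beta>)) * emeasure lebesgue (E k))"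
    by (subst nn_integral_add) (simp_all add: nn_integral_suminf nn_integral_cmult_indicator del: emeasure_completion)
  also have "\<dots> \<le> ennreal (m0 powr (- \<beta>)) * ennreal (V 0) +
      (\<Sum>k. ennreal ((m0 powr (- \<beta>) * r * V 1) * (r * \<theta>) ^ k))"
  proof (intro add_mono suminf_le)
    fix k
    have "ennreal (m (Suc k) powr (- \<beta>)) * emeasure lebesgue (E k)
        \<le> ennreal (m (Suc k) powr (- \<beta>)) * ennreal (\<theta> ^ k * V 1)"
      using level_set_decay[of k] lmeasurable_E[of k]
      by (intro mult_left_mono) (auto simp: emeasure_eq_measure2 \<theta>_def V_def ennreal_leI simp del: emeasure_completion)
    also have "\<dots> = ennreal (m (Suc k) powr (- \<beta>) * (\<theta> ^ k * V 1))"
      using \<theta> by (intro ennreal_mult[symmetric]) (auto simp: V_def)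
    also have "m (Suc k) powr (- \<beta>) * (\<theta> ^ k * V 1) = (m0 powr (- \<beta>) * r * V 1) * (r * \<theta>) ^ k"
      by (simp add: m_Suc_powr r_def power_mult_distrib mult_ac)
    finally show "ennreal (m (Suc k) powr (- \<beta>)) * emeasure lebesgue (E k)
        \<le> ennreal ((m0 powr (- \<beta>) * r * V 1) * (r * \<theta>) ^ k)" .
  qed (simp_all add: em)
  also have "(\<Sum>k. ennreal ((m0 powr (- \<beta>) * r * V 1) * (r * \<theta>) ^ k)) =
      ennreal ((m0 powr (- \<beta>) * r * V 1) * (1 / (1 - r * \<theta>)))"
    using r \<theta> by (intro suminf_ennreal_eq sums_mult geometric_sums) (auto simp: V_def)
  also have "ennreal (m0 powr (- \<beta>)) * ennreal (V 0) + \<dots> =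
      ennreal (m0 powr (- \<beta>) * V 0 + (m0 powr (- \<beta>) * r * V 1) * (1 / (1 - r * \<theta>)))"
    using r \<theta> by (simp add: V_def flip: ennreal_mult ennreal_plus)
  also have "m0 powr (- \<beta>) * V 0 + (m0 powr (- \<beta>) * r * V 1) * (1 / (1 - r * \<theta>)) =
      m0 powr (- \<beta>) * (V 0 + r / (1 - r * \<theta>) * V 1)"
    by (simp add: algebra_simps)
  finally show ?thesis by (simp add: V_def r_def \<theta>_def)
qed

lemma M_eq: "M = 72 * 3 ^ CARD('n) * (2 * C1 * K)"
  by (simp add: M_def overlap_def)

text \<open>The ratio depends only on the dimension and \<open>\<gamma>\<close>, which keeps the
  final bound independent of the rectangle.\<close>

lemma measure_\<Omega>_1:
  "measure lebesgue (\<Omega> 1) = 2 ^ CARD('n) * (1 - \<gamma> / 2) / (1 - \<gamma>) * measure lebesgue (\<Omega> 0)"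
proof -
  have *: "\<gamma> * (1 - s / 2) * L powr p \<le> L powr p" if "0 \<le> s" "s \<le> 1" for s
    using \<gamma>_pos \<gamma>_less_1 that by (intro mult_left_le_one_le mult_nonneg_nonneg mult_le_one) auto
  have **: "measure lebesgue (\<Omega> s) = ((1 + s) * L) ^ CARD('n) * ((1 - \<gamma> * (1 - s / 2)) * L powr p)"
    if "0 \<le> s" "s \<le> 1" for s
    unfolding \<Omega>_def using L *[OF that] that by (subst measure_pbox) (simp_all add: left_diff_distrib)
  show ?thesis
    using **[of 0] **[of 1] \<gamma>_less_1 by (simp add: power_mult_distrib)
qed

end

section \<open>Choice of the constants and the Muckenhoupt bound\<close>

context parabolic_RH_weight
begin

text \<open>All constants except \<open>m0\<close> are chosen before the rectangle. In the product
  of the two averages, the mass of the lower part cancels against \<open>m0\<close>.\<close>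

lemma exists_A_plus: "\<exists>r>1. w \<in> A_plus p r \<gamma>"
proof -
  obtain C1 where C1: "C1 \<ge> 1"
    "\<And>x t l. l > 0 \<Longrightarrow> \<mu> (D x (t - 11 * (2 * l) powr p) (2 * l)) \<le> C1 * \<mu> (D x (t - 12 * l powr p) l)"
    "\<And>x t l. l > 0 \<Longrightarrow> \<mu> (D x (t - 11 * (2 * l) powr p) (2 * l)) \<le> C1 * \<mu> (D x (t - 11 * l powr p) l)"
    using D_past by blast
  \<comment> \<open>The second entry solves
    \<open>K0 powr q * K powr (1 - q) = 1 / (4 * C1)\<close>.\<close>
  define K where "K = max 1 ((4 * C1 * K0 powr q) powr (1 / (q - 1)))"
  have K: "1 \<le> K" "K0 powr q * K powr (1 - q) \<le> 1 / C1 / 4"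
  proof -
    show K1: "1 \<le> K" by (simp add: K_def)
    have "4 * C1 * K0 powr q = ((4 * C1 * K0 powr q) powr (1 / (q - 1))) powr (q - 1)"
      using q_gt_1 C1(1) K0 by (simp add: powr_powr)
    also have "\<dots> \<le> K powr (q - 1)" using q_gt_1 by (intro powr_mono2) (auto simp: K_def)
    finally have "4 * C1 * K0 powr q \<le> K powr (q - 1)" .
    moreover have "K powr (1 - q) = 1 / K powr (q - 1)"
      using powr_minus_divide[of K "q - 1"] by simp
    ultimately show "K0 powr q * K powr (1 - q) \<le> 1 / C1 / 4"
    proof -
      have "K0 powr q * K powr (1 - q) = (4 * C1 * K0 powr q) / K powr (q - 1) / (4 * C1)"
        using C1(1) \<open>K powr (1 - q) = 1 / K powr (q - 1)\<close> by simp
      also have "\<dots> \<le> 1 / (4 * C1)"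
        using C1(1) K1 \<open>4 * C1 * K0 powr q \<le> K powr (q - 1)\<close>
        by (intro divide_right_mono) (auto simp: divide_le_eq_1)
      finally show ?thesis by (simp add: mult.commute)
    qed
  qed
  \<comment> \<open>The first entry yields \<open>24 * \<sigma> \<le> \<gamma>\<close> and, as
    \<open>\<sigma> powr p \<le> \<sigma>\<close>, the condition with 42; the second yields the one
    with 192.\<close>
  define \<sigma> where "\<sigma> = min (\<gamma> / 42) ((\<gamma> / 192) powr (1 / (p - 1)))"
  have \<sigma>: "0 < \<sigma>" "\<sigma> \<le> 1" "24 * \<sigma> \<le> \<gamma>" "42 * \<sigma> powr p \<le> \<gamma>" "192 * \<sigma> powr (p - 1) \<le> \<gamma>"
  proof -
    show 0: "0 < \<sigma>" using \<gamma>_pos by (simp add: \<sigma>_def)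
    have 1: "\<sigma> \<le> \<gamma> / 42" by (simp add: \<sigma>_def)
    then show 2: "\<sigma> \<le> 1" "24 * \<sigma> \<le> \<gamma>" using \<gamma>_less_1 0 by auto
    show "42 * \<sigma> powr p \<le> \<gamma>" using powr_p_le[of \<sigma>] 0 1 2 by linarith
    have "\<sigma> powr (p - 1) \<le> ((\<gamma> / 192) powr (1 / (p - 1))) powr (p - 1)"
      using 0 p_gt_1 by (intro powr_mono2) (auto simp: \<sigma>_def)
    also have "\<dots> = \<gamma> / 192" using p_gt_1 \<gamma>_pos by (simp add: powr_powr)
    finally show "192 * \<sigma> powr (p - 1) \<le> \<gamma>" by simp
  qed
  obtain C2 where C2: "C2 \<ge> 1" "\<And>x0 t0 L x t. L > 0 \<Longrightarrow> (\<forall>i. \<bar>x $ i - x0 $ i\<bar> \<le> L) \<Longrightarrow>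
    t0 + \<gamma> / 2 * L powr p \<le> t \<Longrightarrow> t \<le> t0 + L powr p \<Longrightarrow>
    \<mu> (pbox x0 L (t0 - L powr p) (t0 - \<gamma> * L powr p)) \<le>
      C2 * \<mu> (D x (t - 11 * (\<sigma> * L) powr p) (\<sigma> * L))"
    using initial_box[OF \<sigma>(1,2,4,5)] by blast
  define \<Lambda>0 where "\<Lambda>0 = 4 * C1 * K"
  define M0 where "M0 = 72 * 3 ^ CARD('n) * (2 * C1 * K)"
  have "1 * 1 \<le> C1 * K" using C1(1) K(1) by (intro mult_mono) auto
  then have \<Lambda>0: "\<Lambda>0 > 1" and M0: "M0 > 0" by (simp_all add: \<Lambda>0_def M0_def)
  \<comment> \<open>With \<open>\<Lambda>0 powr \<beta> = 1 + 1 / (2 * M0)\<close> the ratio of the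
    series is \<open>(M0 + 1 / 2) / (M0 + 1)\<close>.\<close>
  define \<beta> where "\<beta> = log \<Lambda>0 (1 + 1 / (2 * M0))"
  have \<Lambda>\<beta>: "\<Lambda>0 powr \<beta> = 1 + 1 / (2 * M0)"
    using \<Lambda>0 M0 unfolding \<beta>_def by (intro powr_log_cancel) (auto intro: add_pos_pos)
  have \<beta>: "\<beta> > 0" "\<Lambda>0 powr \<beta> * (M0 / (1 + M0)) < 1"
  proof -
    have "1 < 1 + 1 / (2 * M0)" using M0 by simp
    moreover from this have "0 < 1 + 1 / (2 * M0)" by linarith
    ultimately show "\<beta> > 0" unfolding \<beta>_def using \<Lambda>0 by (simp only: zero_less_log_cancel_iff)
    have "(1 + 1 / (2 * M0)) * M0 = M0 + 1 / 2" using M0 by (simp add: distrib_right)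
    then show "\<Lambda>0 powr \<beta> * (M0 / (1 + M0)) < 1"
      using M0 by (simp add: \<Lambda>\<beta> divide_less_eq)
  qed
  \<comment> \<open>Chosen so that the exponent \<open>1 / (1 - r)\<close> is
    \<open>- \<beta>\<close>.\<close>
  define r where "r = 1 + 1 / \<beta>"
  have r: "r > 1" "1 / (1 - r) = - \<beta>" "r - 1 = 1 / \<beta>" using \<beta> by (auto simp: r_def)
  define Q where "Q = 1 + \<Lambda>0 powr \<beta> / (1 - \<Lambda>0 powr \<beta> * (M0 / (1 + M0))) * (2 ^ CARD('n) * (1 - \<gamma> / 2) / (1 - \<gamma>))"
  have Q: "Q > 0" unfolding Q_def using \<beta> \<gamma>_less_1 by (intro add_pos_nonneg mult_nonneg_nonneg divide_nonneg_nonneg) auto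
  define bound where "bound = Q powr (1 / \<beta>) * C2 * (\<sigma> ^ CARD('n) * \<sigma> powr p) / (1 - \<gamma>)"
  have main: "avg (para_lower p \<gamma> x0 t0 L) (\<lambda>z. ennreal (w z)) *
      ennpowr (avg (para_upper p \<gamma> x0 t0 L) (\<lambda>z. ennpowr (ennreal (w z)) (1 / (1 - r)))) (r - 1)
      \<le> ennreal bound" if L: "L > 0" for x0 t0 L
  proof -
    define V where "V = L ^ CARD('n) * ((1 - \<gamma>) * L powr p)"
    have V: "V > 0" using L \<gamma>_less_1 by (simp add: V_def)
    have g: "\<gamma> * L powr p \<le> L powr p" using \<gamma>_less_1 \<gamma>_pos by (intro mult_left_le_one_le) auto
    have lo: "para_lower p \<gamma> x0 t0 L = pbox x0 L (t0 - L powr p) (t0 - \<gamma> * L powr p)"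
      and up: "para_upper p \<gamma> x0 t0 L = pbox x0 L (t0 + \<gamma> * L powr p) (t0 + L powr p)"
      by (auto simp: para_lower_def para_upper_def pbox_def)
    have elo: "emeasure lebesgue (para_lower p \<gamma> x0 t0 L) = ennreal V"
      and eup: "emeasure lebesgue (para_upper p \<gamma> x0 t0 L) = ennreal V"
      unfolding lo up using L g
      by (subst emeasure_pbox; simp add: V_def algebra_simps)+
    define \<mu>0 where "\<mu>0 = \<mu> (para_lower p \<gamma> x0 t0 L)"
    have "(\<integral>\<^sup>+z\<in>para_lower p \<gamma> x0 t0 L. ennreal (w z) \<partial>lebesgue) = ennreal \<mu>0"
      unfolding \<mu>0_def lo using wmeasure_pbox[of x0 L "t0 - L powr p" "t0 - \<gamma> * L powr p"] by (simp add: wmeasure_def)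
    then have avg_lo: "avg (para_lower p \<gamma> x0 t0 L) (\<lambda>z. ennreal (w z)) = ennreal (\<mu>0 / V)"
      unfolding avg_def elo using V by (simp add: divide_ennreal \<mu>0_def)
    show ?thesis
    \<comment> \<open>If the lower part has no mass, the product vanishes even when the other factor
      is infinite; otherwise \<open>m0\<close> can be taken positive.\<close>
    proof (cases "\<mu>0 = 0")
      case True
      then show ?thesis by (simp add: avg_lo)
    next
      case False
      then have \<mu>0: "\<mu>0 > 0" by (simp add: \<mu>0_def measure_nonneg less_le)
      have v: "vol (\<sigma> * L) > 0" using \<sigma> L by (intro vol_pos) simp
      \<comment> \<open>Then \<open>m0 * vol (\<sigma> * L)\<close> is \<open>\<mu>0 / C2\<close>,
        the lower bound that \<open>initial_box\<close> supplies.\<close>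
      define m0 where "m0 = \<mu>0 / (C2 * vol (\<sigma> * L))"
      have m0: "m0 > 0" using \<mu>0 C2(1) v by (simp add: m0_def)
      interpret level_set_decay w p \<gamma> c q K0 x0 t0 L \<sigma> C1 K m0
      proof
        fix x :: "real^'n" and t
        assume "\<forall>i. \<bar>x $ i - x0 $ i\<bar> \<le> L" "t0 + \<gamma> / 2 * L powr p \<le> t" "t \<le> t0 + L powr p"
        from C2(2)[OF L this]
        show "m0 * vol (\<sigma> * L) \<le> \<mu> (D x (t - 11 * (\<sigma> * L) powr p) (\<sigma> * L))"
          using C2(1) v by (simp add: m0_def \<mu>0_def lo field_simps)
      qed (use L \<sigma> C1 K m0 in auto)

      have K': "\<Lambda> = \<Lambda>0" "M = M0" by (simp_all add: \<Lambda>_def \<Lambda>0_def M_eq M0_def)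
      have \<Omega>0: "\<Omega> 0 = para_upper p \<gamma> x0 t0 L" by (simp add: \<Omega>_def up)
      have mV: "measure lebesgue (\<Omega> 0) = V"
        using eup V by (simp add: \<Omega>0 measure_def del: emeasure_completion)
      have "(\<integral>\<^sup>+z\<in>para_upper p \<gamma> x0 t0 L. ennpowr (ennreal (w z)) (- \<beta>) \<partial>lebesgue)
          \<le> ennreal (m0 powr (- \<beta>) * (V * Q))"
      proof -
        have eq: "measure lebesgue (\<Omega> 0) + \<Lambda> powr \<beta> / (1 - \<Lambda> powr \<beta> * (M / (1 + M))) * measure lebesgue (\<Omega> 1) = V * Q"
          unfolding measure_\<Omega>_1 mV K' Q_def by (simp only: distrib_left mult_1_right mult.commute mult.left_commute)
        have "\<Lambda> powr \<beta> * (M / (1 + M)) < 1" using \<beta>(2) by (simp only: K')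
        from negative_power_integral[OF \<beta>(1) this] show ?thesis unfolding eq unfolding \<Omega>0 .
      qed
      then have "avg (para_upper p \<gamma> x0 t0 L) (\<lambda>z. ennpowr (ennreal (w z)) (1 / (1 - r)))
          \<le> ennreal (m0 powr (- \<beta>) * (V * Q)) / ennreal V"
        unfolding avg_def eup r(2) by (rule divide_right_mono_ennreal)
      also have "\<dots> = ennreal (m0 powr (- \<beta>) * Q)"
        using V Q by (simp add: divide_ennreal)
      finally have "ennpowr (avg (para_upper p \<gamma> x0 t0 L) (\<lambda>z. ennpowr (ennreal (w z)) (1 / (1 - r)))) (r - 1)
          \<le> ennpowr (ennreal (m0 powr (- \<beta>) * Q)) (r - 1)"
        using r(1) by (intro ennpowr_mono) auto
      also have "\<dots> = ennreal ((m0 powr (- \<beta>) * Q) powr (1 / \<beta>))"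
        using r(3) \<beta>(1) Q by (subst ennpowr_pos) auto
      also have "(m0 powr (- \<beta>) * Q) powr (1 / \<beta>) = Q powr (1 / \<beta>) / m0"
        using \<beta>(1) Q m0 by (simp add: powr_divide powr_powr powr_minus_divide)
      finally have "avg (para_lower p \<gamma> x0 t0 L) (\<lambda>z. ennreal (w z)) *
          ennpowr (avg (para_upper p \<gamma> x0 t0 L) (\<lambda>z. ennpowr (ennreal (w z)) (1 / (1 - r)))) (r - 1)
          \<le> ennreal (\<mu>0 / V) * ennreal (Q powr (1 / \<beta>) / m0)"
        unfolding avg_lo by (intro mult_left_mono) auto
      also have "\<dots> = ennreal (\<mu>0 / V * (Q powr (1 / \<beta>) / m0))"
        using \<mu>0 V m0 by (intro ennreal_mult[symmetric]) auto
      also have "\<mu>0 / V * (Q powr (1 / \<beta>) / m0) = Q powr (1 / \<beta>) * C2 * (vol (\<sigma> * L) / V)"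
        using \<mu>0 by (simp add: m0_def)
      also have "vol (\<sigma> * L) / V = \<sigma> ^ CARD('n) * \<sigma> powr p / (1 - \<gamma>)"
        using L \<sigma>(1) \<gamma>_less_1 by (simp add: vol_def V_def power_mult_distrib powr_mult)
      finally show ?thesis by (simp add: bound_def)
    qed
  qed
  have "w \<in> A_plus p r \<gamma>"
  proof -
    have "(SUP (x, t, L) \<in> {(x, t, L). L > 0}.
        avg (para_lower p \<gamma> x t L) (\<lambda>z. ennreal (w z)) *
        ennpowr (avg (para_upper p \<gamma> x t L) (\<lambda>z. ennpowr (ennreal (w z)) (1 / (1 - r)))) (r - 1)) \<le> ennreal bound"
      using main by (intro SUP_least) auto
    also have "\<dots> < \<infinity>" by simp
    finally show ?thesis using weight by (simp add: A_plus_def)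
  qed
  then show ?thesis using r(1) by blast
qed

end

text \<open>Brings the reverse Hoelder hypothesis into the form assumed in
  \<open>parabolic_RH_weight\<close>, by undoing the root and the average.\<close>

lemma RH_plus_D:
  fixes w :: "(real^'n::finite) \<times> real \<Rightarrow> real"
  assumes p: "1 < p" and q: "1 < q" and w: "w \<in> RH_plus p q"
  shows "\<exists>K0>0. \<forall>x u l. l > 0 \<longrightarrow>
    (\<integral>\<^sup>+z\<in>pbox x l u (u + l powr p). ennreal (w z powr q) \<partial>lebesgue) \<le>
      ennreal (l ^ CARD('n) * l powr p *
        (K0 * (measure (wmeas w) (pbox x l (u + l powr p) (u + l powr p + l powr p)) / (l ^ CARD('n) * l powr p))) powr q)"
proof -
  obtain C where wt: "weight w" and C: "\<And>x t L. L > 0 \<Longrightarrow>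
      ennpowr (avg (para_lower p 0 x t L) (\<lambda>z. ennpowr (ennreal (w z)) q)) (1 / q)
          \<le> ennreal C * avg (para_upper p 0 x t L) (\<lambda>z. ennreal (w z))"
    using w by (auto simp: RH_plus_def)
  have w0: "0 \<le> w z" for z using wt unfolding weight_def by blast
  define K0 where "K0 = max 1 C"
  have K0: "K0 > 0" "C \<le> K0" by (auto simp: K0_def)
  show ?thesis
  proof (intro exI[of _ K0] conjI allI impI K0)
    fix x :: "real^'n" and u l :: real assume l: "l > 0"
    define V where "V = l ^ CARD('n) * l powr p"
    have V: "V > 0" using l by (simp add: V_def)
    define A where "A = pbox x l u (u + l powr p)"
    define A' where "A' = pbox x l (u + l powr p) (u + l powr p + l powr p)"
    define \<mu> where "\<mu> = measure (wmeas w) A'"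
    define I where "I = (\<integral>\<^sup>+z\<in>A. ennreal (w z powr q) \<partial>lebesgue)"
    have lo: "para_lower p 0 x (u + l powr p) l = A" and up: "para_upper p 0 x (u + l powr p) l = A'"
      by (simp_all add: para_lower_def para_upper_def A_def A'_def pbox_def)
    have eA: "emeasure lebesgue A = ennreal V" "emeasure lebesgue A' = ennreal V"
      unfolding A_def A'_def using l by (subst emeasure_pbox; simp add: V_def)+
    have "avg A' (\<lambda>z. ennreal (w z)) = ennreal (\<mu> / V)"
    proof -
      have "(\<integral>\<^sup>+z\<in>A'. ennreal (w z) \<partial>lebesgue) = ennreal \<mu>"
        using wmeasure_eq_measure[OF wt, of A'] by (simp add: A'_def bounded_pbox wmeasure_def \<mu>_def)
      then show ?thesis using V by (simp add: avg_def eA divide_ennreal \<mu>_def del: emeasure_completion)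
    qed
    moreover have "avg A (\<lambda>z. ennpowr (ennreal (w z)) q) = I / ennreal V"
      using q w0 by (simp add: avg_def eA I_def ennpowr_pos del: emeasure_completion)
    ultimately have "ennpowr (I / ennreal V) (1 / q) \<le> ennreal C * ennreal (\<mu> / V)"
      using C[OF l, of x "u + l powr p"] unfolding lo up by simp
    also have "\<dots> \<le> ennreal K0 * ennreal (\<mu> / V)" using K0 by (intro mult_right_mono ennreal_leI) auto
    also have "\<dots> = ennreal (K0 * (\<mu> / V))" using K0 V by (intro ennreal_mult[symmetric]) (auto simp: \<mu>_def)
    finally have le: "ennpowr (I / ennreal V) (1 / q) \<le> ennreal (K0 * (\<mu> / V))" .
    have "I \<le> ennreal (V * (K0 * (\<mu> / V)) powr q)"
    proof (cases "I / ennreal V")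
      case (real s)
      have "ennreal (s powr (1 / q)) \<le> ennreal (K0 * (\<mu> / V))"
        using le real q by (simp add: ennpowr_pos)
      then have "s powr (1 / q) \<le> K0 * (\<mu> / V)"
        using K0 V by (subst (asm) ennreal_le_iff) (auto simp: \<mu>_def)
      then have "(s powr (1 / q)) powr q \<le> (K0 * (\<mu> / V)) powr q" using q by (intro powr_mono2) auto
      then have s: "s \<le> (K0 * (\<mu> / V)) powr q" using q real by (simp add: powr_powr)
      have "I = I / ennreal V * ennreal V"
        using V by (simp add: ennreal_divide_times ennreal_mult_divide_eq)
      also have "\<dots> = ennreal (s * V)" using real V by (simp add: ennreal_mult)
      also have "\<dots> \<le> ennreal (V * (K0 * (\<mu> / V)) powr q)"
        using s V by (intro ennreal_leI) (simp add: mult.commute)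
      finally show ?thesis .
    next
      \<comment> \<open>An infinite average would contradict the finite bound
        \<open>le\<close>.\<close>
      case top
      then show ?thesis using le q by (simp add: ennpowr_def top_unique)
    qed
    then show "(\<integral>\<^sup>+z\<in>pbox x l u (u + l powr p). ennreal (w z powr q) \<partial>lebesgue) \<le>
      ennreal (l ^ CARD('n) * l powr p *
        (K0 * (measure (wmeas w) (pbox x l (u + l powr p) (u + l powr p + l powr p)) / (l ^ CARD('n) * l powr p))) powr q)"
      by (simp add: I_def A_def A'_def V_def \<mu>_def)
  qed
qed

theorem theorem5p3:
  fixes w :: "(real ^ 'n::finite) \<times> real \<Rightarrow> real" and p q \<gamma> :: real
  assumes "1 < p" and "1 < q" and "0 < \<gamma>" and "\<gamma> < 1"
    and "weight w"
    and "w \<in> RH_plus p q"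
    and "forward_doubling p \<gamma> w"
  shows "\<exists>r>1. w \<in> A_plus p r \<gamma>"
proof -
  obtain c where c: "\<And>x t L. L > 0 \<Longrightarrow>
      wmeasure w (para_lower p \<gamma> x t L) \<le> ennreal c * wmeasure w (half_para_upper p \<gamma> x t L)"
    using assms(7) by (auto simp: forward_doubling_def)
  \<comment> \<open>A constant of at least 1 makes \<open>c ^ N\<close> monotone in the number of
    chain steps, as \<open>B_chain\<close> uses.\<close>
  interpret forward_doubling_weight w p \<gamma> "max 1 c"
  proof
    fix L t :: real and x :: "real^'n" assume "L > 0"
    then have "wmeasure w (para_lower p \<gamma> x t L) \<le> ennreal c * wmeasure w (half_para_upper p \<gamma> x t L)" by (rule c)
    also have "\<dots> \<le> ennreal (max 1 c) * wmeasure w (half_para_upper p \<gamma> x t L)"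
      by (intro mult_right_mono ennreal_leI) auto
    finally show "wmeasure w (para_lower p \<gamma> x t L) \<le> ennreal (max 1 c) * wmeasure w (half_para_upper p \<gamma> x t L)" .
  qed (use assms in auto)
  obtain K0 where K0: "K0 > 0" "\<And>x u l. l > 0 \<Longrightarrow>
    (\<integral>\<^sup>+z\<in>pbox x l u (u + l powr p). ennreal (w z powr q) \<partial>lebesgue) \<le>
      ennreal (l ^ CARD('n) * l powr p *
        (K0 * (measure (wmeas w) (pbox x l (u + l powr p) (u + l powr p + l powr p)) / (l ^ CARD('n) * l powr p))) powr q)"
    using RH_plus_D[OF assms(1,2,6)] by blast
  interpret parabolic_RH_weight w p \<gamma> "max 1 c" q K0
    by unfold_locales (use assms K0 in \<open>auto simp: D_def vol_def\<close>)
  show ?thesis by (rule exists_A_plus)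
qed

end
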